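(* (a) Let $f,g\in\mathrm{SQH}$ be such that $f\diamond g$ is defined. Then there exists an integer $M\ge 0$ such that $(f\diamond g)z^M\in L^1(\mathbb{D},dA)$ and $T_fT_{g\cdot z^M}-T_{(f\diamond g)z^M}$ is a finite rank operator. (b) Let $F_1,\ldots,F_N$ and $G_1,\ldots,G_N$ belong to $\mathrm{SQH}$ and be such that $F_j\diamond G_j$ is defined for all $1\le j\le N$. Let $H\in L^1(\mathbb{D},dA)$. Then $\sum_{j=1}^{N}T_{F_j}T_{G_j}-T_H$ has finite rank if and only if $\sum_{j=1}^{N}F_j\diamond G_j$ belongs to $L^1(\mathbb{D},dA)$ and $H=\sum_{j=1}^{N}F_j\diamond G_j$ (almost everywhere).
   Context: $\mathbb{D}$ is the open unit disk in $\mathbb{C}$, $dA$ is normalized Lebesgue area measure on $\mathbb{D}$, and $A^2$ is the Bergman space of holomorphic functions on $\mathbb{D}$ that are square integrable with respect to $dA$. The class $\mathrm{SQH}$ is the set of all finite sums $\sum_{m\in E}f_m$, where $E\subset\mathbb{Z}$ is finite and $f_m(re^{i\theta})=\phi_m(r)e^{im\theta}\in L^1(\mathbb{D},dA)$ for every $m\in E$. Toeplitz operators. For $f\in L^1(\mathbb{D},dA)$, the Toeplitz operator $T_f$ is defined (at least) on holomorphic polynomials $h$ by $T_f(h)(z)=\int_{\mathbb{D}}\frac{f(w)h(w)}{(1-\bar w z)^2}\,dA(w)$, $z\in\mathbb{D}$. Toeplitz operators with symbols in $\mathrm{SQH}$ map holomorphic polynomials to holomorphic polynomials, so products of two such operators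 are defined on holomorphic polynomials. A finite sum of products of such (possibly unbounded) operators, whose domain contains the holomorphic polynomials, is said to have finite rank if the image of the space of holomorphic polynomials is finite dimensional. Mellin transform. For a measurable function $\varphi$ on $(0,1)$, $\widehat{\varphi}(\zeta)=\int_0^1\varphi(r)r^{\zeta-1}\,dr$ for all $\zeta\in\mathbb{C}$ for which the integral exists. Nearly integrable functions. A measurable function $\varphi$ on $(0,1)$ is nearly integrable if $\varphi\in L^1((0,1),r^{\alpha}dr)$ for some $\alpha>0$; a measurable function $f$ on $\mathbb{D}$ is nearly integrable if $f\in L^1(\mathbb{D},|z|^{\alpha}dA)$ for some $\alpha>0$. A function on $\mathbb{D}$ is quasihomogeneous of degree $m\in\mathbb{Z}$ if it equals $\phi(r)e^{im\theta}$ (with $z=re^{i\theta}$) almost everywhere for some function $\phi$. Convolution $\diamond$. (i) Let $f_m(re^{i\theta})=\phi(r)e^{im\theta}$ and $g_n(re^{i\theta})=\psi(r)e^{in\theta}$ be nearly integrable. If there is a nearly integrable function $\omega$ on $(0,1)$ with $\widehat{\omega}(\zeta)=(\zeta-m+n)\,\widehat{\phi}(\zeta+n)\,\widehat{\psi}(\zeta-m)$ on some right half-plane in $\mathbb{C}$, then $f_m\diamond g_n$ is defined as $(f_m\diamond g_n)(re^{i\theta})=\omega(r)e^{i(m+n)\theta}$. (ii) If $f=\sum_m f_m$ and $g=\sum_n g_n$ are finite sums of nearly integrable quasihomogeneous functions ($f_m$ of degree $m$, $g_n$ of degree $n$) and $f_m\diamond g_n$ exists for every pair $(m,n)$, then $f\diamond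 g$ is defined as $f\diamond g=\sum_{m,n}f_m\diamond g_n$. *)

theory Defs
  imports "HOL-Analysis.Analysis" "HOL-Library.Function_Algebras"
begin

text \<open>
  Functions on the open unit disk and on (0,1) are represented by total functions on
  \<^typ>\<open>complex\<close> and \<^typ>\<open>real\<close>; the measures below ignore their values elsewhere.
  Elements of $L^1$ are functions, not classes, so equalities between them are stated
  almost everywhere.
\<close>

definition dA :: "complex measure" where
  "dA = density (lebesgue_on (ball 0 1)) (\<lambda>_. ennreal (1 / pi))"

abbreviation unit_interval_measure :: "real measure" where
  "unit_interval_measure \<equiv> lebesgue_on {0<..<1}"


definition qhom :: "int \<Rightarrow> (real \<Rightarrow> complex) \<Rightarrow> complex \<Rightarrow> complex" where
  "qhom m \<phi> z = \<phi> (norm z) * cis (of_int m * Arg z)"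

definition SQH :: "(complex \<Rightarrow> complex) set" where
  "SQH = {f. \<exists>E \<phi>. finite E \<and> (\<forall>m\<in>E. integrable dA (qhom m (\<phi> m))) \<and>
                   (AE z in dA. f z = (\<Sum>m\<in>E. qhom m (\<phi> m) z))}"


text \<open>
  The operator is given by the integral formula on every function \<open>h\<close>; only polynomials, and
  functions agreeing with a polynomial on the disk, are ever used as arguments. The
  value 0 off the disk makes equality of the resulting total functions the same as equality
  on the disk.
\<close>

definition toeplitz :: "(complex \<Rightarrow> complex) \<Rightarrow> (complex \<Rightarrow> complex) \<Rightarrow> complex \<Rightarrow> complex" where
  "toeplitz f h = (\<lambda>z. if z \<in> ball 0 1
                        then (\<integral>w. f w * h w / (1 - cnj w * z)\<^sup>2 \<partial>dA) else 0)"

definition fun_scale :: "complex \<Rightarrow> (complex \<Rightarrow> complex) \<Rightarrow> complex \<Rightarrow> complex" where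
  "fun_scale c f = (\<lambda>z. c * f z)"

global_interpretation fun_space: vector_space fun_scale
  by unfold_locales (auto simp: fun_scale_def fun_eq_iff algebra_simps)

definition finite_rank :: "((complex \<Rightarrow> complex) \<Rightarrow> complex \<Rightarrow> complex) \<Rightarrow> bool" where
  "finite_rank S \<longleftrightarrow> (\<exists>B. finite B \<and> S ` range poly \<subseteq> fun_space.span B)"


definition mellin_exists :: "(real \<Rightarrow> complex) \<Rightarrow> complex \<Rightarrow> bool" where
  "mellin_exists \<phi> \<zeta> \<longleftrightarrow>
     integrable unit_interval_measure (\<lambda>r. \<phi> r * of_real r powr (\<zeta> - 1))"

definition mellin :: "(real \<Rightarrow> complex) \<Rightarrow> complex \<Rightarrow> complex" where
  "mellin \<phi> \<zeta> = (\<integral>r. \<phi> r * of_real r powr (\<zeta> - 1) \<partial>unit_interval_measure)"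

text \<open>
  The weights below are positive almost everywhere, so integrability of the product already
  contains measurability of the function.
\<close>

definition nearly_integrable :: "(real \<Rightarrow> complex) \<Rightarrow> bool" where
  "nearly_integrable \<phi> \<longleftrightarrow>
     (\<exists>\<alpha>>0. integrable unit_interval_measure (\<lambda>r. of_real (r powr \<alpha>) * \<phi> r))"

definition nearly_integrable_disk :: "(complex \<Rightarrow> complex) \<Rightarrow> bool" where
  "nearly_integrable_disk f \<longleftrightarrow>
     (\<exists>\<alpha>>0. integrable dA (\<lambda>z. of_real (norm z powr \<alpha>) * f z))"


text \<open>
  \<open>is_diamond_qhom m \<phi> n \<psi> \<omega>\<close>: the convolution of \<open>qhom m \<phi>\<close> and \<open>qhom n \<psi>\<close> exists
  and is \<open>qhom (m + n) \<omega>\<close>.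
\<close>

definition is_diamond_qhom ::
  "int \<Rightarrow> (real \<Rightarrow> complex) \<Rightarrow> int \<Rightarrow> (real \<Rightarrow> complex) \<Rightarrow> (real \<Rightarrow> complex) \<Rightarrow> bool" where
  "is_diamond_qhom m \<phi> n \<psi> \<omega> \<longleftrightarrow>
     nearly_integrable_disk (qhom m \<phi>) \<and> nearly_integrable_disk (qhom n \<psi>) \<and>
     nearly_integrable \<omega> \<and>
     (\<exists>a::real. \<forall>\<zeta>. Re \<zeta> > a \<longrightarrow>
        mellin_exists \<omega> \<zeta> \<and> mellin_exists \<phi> (\<zeta> + of_int n) \<and> mellin_exists \<psi> (\<zeta> - of_int m) \<and>
        mellin \<omega> \<zeta> = (\<zeta> - of_int m + of_int n) * mellin \<phi> (\<zeta> + of_int n) * mellin \<psi> (\<zeta> - of_int m))"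

text \<open>
  \<open>is_diamond f g k\<close>: the convolution of \<open>f\<close> and \<open>g\<close> is defined, and \<open>k\<close> is a representative
  of it. The convolution is only determined almost everywhere, hence a relation instead of a
  function. The conditions on single \<open>\<phi> m\<close> and \<open>\<psi> n\<close> are stated separately because the index sets
  may be empty.
\<close>

definition is_diamond ::
  "(complex \<Rightarrow> complex) \<Rightarrow> (complex \<Rightarrow> complex) \<Rightarrow> (complex \<Rightarrow> complex) \<Rightarrow> bool" where
  "is_diamond f g k \<longleftrightarrow>
     (\<exists>E E' \<phi> \<psi> \<omega>. finite E \<and> finite E' \<and>
        (\<forall>m\<in>E. nearly_integrable_disk (qhom m (\<phi> m))) \<and>
        (\<forall>n\<in>E'. nearly_integrable_disk (qhom n (\<psi> n))) \<and>
        (AE z in dA. f z = (\<Sum>m\<in>E. qhom m (\<phi> m) z)) \<and>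
        (AE z in dA. g z = (\<Sum>n\<in>E'. qhom n (\<psi> n) z)) \<and>
        (\<forall>m\<in>E. \<forall>n\<in>E'. is_diamond_qhom m (\<phi> m) n (\<psi> n) (\<omega> m n)) \<and>
        (AE z in dA. k z = (\<Sum>m\<in>E. \<Sum>n\<in>E'. qhom (m + n) (\<omega> m n) z)))"

end

theory Submission
  imports Defs "HOL-Complex_Analysis.Cauchy_Integral_Formula" "Jordan_Normal_Form.Determinant"
begin

text \<open>
  The proof rests on one identity and one rigidity theorem.

  \<^emph>\<open>The identity.\<close> For \<open>f = \<phi>(r) e\<^sup>i\<^sup>m\<^sup>\<theta>\<close> the operator \<open>T\<^sub>f\<close> sends \<open>w^k\<close> to
  \<open>2 (m + k + 1) M\<phi>(2 k + m + 2) w^(m + k)\<close>, where \<open>M\<phi>\<close> is the Mellin transform, and to \<open>0\<close> if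
  \<open>m + k < 0\<close>: the angular part of the integral leaves a single term of the expansion of the
  Bergman kernel, and its radial part is a Mellin transform (\<open>toeplitz_qhom_monomial\<close>,
  \<open>toeplitz_coeff_mellin\<close>). Composing two such operators, the equation that defines the convolution,
  read at \<open>\<zeta> = 2 k + m + n + 2\<close>, says exactly that \<open>T\<^sub>f T\<^sub>g\<close> and the Toeplitz operator of the
  convolution agree on \<open>w^k\<close>, as soon as \<open>k\<close> is so large that \<open>\<zeta>\<close> lies in the half-plane where the
  equation holds and that all exponents are nonnegative. The convolution \<open>h\<close> of \<open>f\<close> and \<open>g\<close> is only
  nearly integrable; for large \<open>M\<close> the product \<open>h z^M\<close> is integrable and
  \<open>T\<^sub>f T\<^sub>g w^(j + M) = T\<^bsub>h z^M\<^esub> w^j\<close> for every \<open>j \<ge> 0\<close> (\<open>diamond_toeplitz_shift\<close>). Hence the operator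
  of the first part vanishes on all polynomials. In the second part the operator \<open>S\<close> satisfies
  \<open>S w^(j + M) = T\<^sub>V w^j\<close> with \<open>V = (\<Sum> K\<^sub>j - H) z^M\<close>. If \<open>V = 0\<close>, its range is spanned by the
  finitely many \<open>S w^i\<close> with \<open>i < M\<close>; if \<open>S\<close> has finite rank, so has \<open>T\<^sub>V\<close>.

  \<^emph>\<open>The rigidity theorem.\<close> A Toeplitz operator of finite rank with symbol \<open>v\<close> in \<open>L\<^sup>1\<close> is zero
  (\<open>toeplitz_finite_rank_imp_AE_0\<close>). This is Luecking's theorem for absolutely continuous measures;
  the proof given here replaces his several-variable argument by Liouville's theorem. Let
  \<open>U(a, b) = \<integral> v exp(a z + b cnj z)\<close>. Finite rank of the operator makes all large minors
  \<open>det U(s\<^sub>j, t\<^sub>k)\<close> vanish. If \<open>r\<close> is the largest order of a nonvanishing minor, then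
  \<open>E(a) = det U(a + s\<^sub>j, - cnj a + t\<^sub>k)\<close> factors as an entire function, times a constant, times the
  conjugate of an entire function. As \<open>a z - cnj (a z)\<close> is imaginary, \<open>E\<close> is bounded, so \<open>\<bar>E\<bar>\<close> is
  constant by Liouville, and nonzero at \<open>a = 0\<close>. But the entries of the matrix are Fourier
  transforms of \<open>L\<^sup>1\<close> functions, and a Wiener-type averaging argument makes all of them small at the
  same \<open>a\<close>. Hence \<open>r = 0\<close>, \<open>U = 0\<close>, and \<open>v = 0\<close> because \<open>U\<close> determines the Fourier transform of \<open>v\<close>.
  For a finite sum of point masses every step but the averaging goes through.
\<close>

(* Throughout, $ and \<bullet> denote the components and the inner product of Euclidean vectors. *)
no_notation vec_index (infixl \<open>$\<close> 100) and scalar_prod (infix \<open>\<bullet>\<close> 70)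


section \<open>Minors of a kernel\<close>

definition kernel_mat :: "('a \<Rightarrow> 'b \<Rightarrow> complex) \<Rightarrow> (nat \<Rightarrow> 'a) \<Rightarrow> (nat \<Rightarrow> 'b) \<Rightarrow> nat \<Rightarrow> complex mat" where
  "kernel_mat U s t n = mat n n (\<lambda>(i, j). U (s i) (t j))"

lemma kernel_mat_carrier [simp, intro]: "kernel_mat U s t n \<in> carrier_mat n n"
  by (simp add: kernel_mat_def)

lemma permutes_less_bound: "p permutes {0..<n} \<Longrightarrow> i < n \<Longrightarrow> p i < n" for i n :: nat
  using permutes_in_image[of p "{0..<n}" i] by simp

lemma det_kernel_mat:
  "det (kernel_mat U s t n) =
     (\<Sum>p\<in>{p. p permutes {0..<n}}. signof p * (\<Prod>i = 0..<n. U (s i) (t (p i))))"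
proof -
  have "(\<Prod>i = 0..<n. kernel_mat U s t n $$ (i, p i)) = (\<Prod>i = 0..<n. U (s i) (t (p i)))"
    if "p permutes {0..<n}" for p
    using that by (intro prod.cong) (auto simp: kernel_mat_def permutes_less_bound[OF that])
  then show ?thesis
    by (subst det_def'[OF kernel_mat_carrier]) (auto intro!: sum.cong)
qed

lemma det_kernel_mat_eq_0_iff:
  "det (kernel_mat U s t n) = 0 \<longleftrightarrow>
     (\<exists>c. (\<exists>j<n. c j \<noteq> 0) \<and> (\<forall>i<n. (\<Sum>j<n. U (s i) (t j) * c j) = 0))" (is "_ \<longleftrightarrow> ?R")
proof -
  have "det (kernel_mat U s t n) = 0 \<longleftrightarrow>
      (\<exists>v. v \<in> carrier_vec n \<and> v \<noteq> 0\<^sub>v n \<and> kernel_mat U s t n *\<^sub>v v = 0\<^sub>v n)"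
    by (rule det_0_iff_vec_prod_zero_field) simp
  also have "\<dots> \<longleftrightarrow> ?R"
  proof
    assume "\<exists>v. v \<in> carrier_vec n \<and> v \<noteq> 0\<^sub>v n \<and> kernel_mat U s t n *\<^sub>v v = 0\<^sub>v n"
    then obtain v :: "complex Matrix.vec" where v: "v \<in> carrier_vec n" "v \<noteq> 0\<^sub>v n"
      and 0: "kernel_mat U s t n *\<^sub>v v = 0\<^sub>v n" by blast
    from v have "\<exists>j<n. vec_index v j \<noteq> 0"
      by (metis carrier_vecD eq_vecI index_zero_vec(1) index_zero_vec(2))
    moreover have "(\<Sum>j<n. U (s i) (t j) * vec_index v j) = 0" if "i < n" for i
    proof -
      have "vec_index (kernel_mat U s t n *\<^sub>v v) i = 0"
        using 0 that by simp
      then show ?thesis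
        using that v by (simp add: kernel_mat_def scalar_prod_def atLeast0LessThan)
    qed
    ultimately show ?R by blast
  next
    assume ?R
    then obtain c k where c: "k < n" "c k \<noteq> 0" "\<And>i. i < n \<Longrightarrow> (\<Sum>j<n. U (s i) (t j) * c j) = 0"
      by blast
    have "Matrix.vec n c \<noteq> 0\<^sub>v n"
      using c by (metis index_vec index_zero_vec(1))
    moreover have "kernel_mat U s t n *\<^sub>v Matrix.vec n c = 0\<^sub>v n"
      using c by (intro eq_vecI) (auto simp: kernel_mat_def scalar_prod_def atLeast0LessThan)
    ultimately show "\<exists>v. v \<in> carrier_vec n \<and> v \<noteq> 0\<^sub>v n \<and> kernel_mat U s t n *\<^sub>v v = 0\<^sub>v n"
      by (intro exI[of _ "Matrix.vec n c"]) auto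
  qed
  finally show ?thesis .
qed

lemma det_kernel_mat_flip:
  "det (kernel_mat U s t n) = det (kernel_mat (\<lambda>b a. U a b) t s n)"
proof -
  have "transpose_mat (kernel_mat U s t n) = kernel_mat (\<lambda>b a. U a b) t s n"
    by (rule eq_matI) (auto simp: kernel_mat_def)
  then show ?thesis
    by (metis Determinant.det_transpose kernel_mat_carrier)
qed

text \<open>
  A kernel whose minors of order \<open>r + 1\<close> vanish is reproduced from its values on the rows \<open>s\<close> and
  columns \<open>t\<close> of a nonvanishing minor of order \<open>r\<close>: bordering that minor with a row \<open>a\<close> and a column
  \<open>b\<close> gives a singular matrix, and a kernel vector of it expresses the column \<open>b\<close> through the
  columns \<open>t\<close>.
\<close>

lemma kernel_factorization:
  assumes nz: "det (kernel_mat U s t r) \<noteq> 0"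
    and sing: "\<And>s t. det (kernel_mat U s t (Suc r)) = 0"
  obtains C where "C \<in> carrier_mat r r"
    "\<And>a b. U a b = (\<Sum>k<r. \<Sum>l<r. U a (t k) * C $$ (k, l) * U (s l) b)"
proof -
  obtain C where C: "C \<in> carrier_mat r r" and inv: "C * kernel_mat U s t r = 1\<^sub>m r"
  proof
    let ?A = "kernel_mat U s t r" and ?C = "inverse (det (kernel_mat U s t r)) \<cdot>\<^sub>m adj_mat (kernel_mat U s t r)"
    note adj = adj_mat[OF kernel_mat_carrier[of U s t r]]
    show "?C \<in> carrier_mat r r" using adj(1) by simp
    show "?C * ?A = 1\<^sub>m r"
      unfolding mult_smult_assoc_mat[OF adj(1) kernel_mat_carrier] adj(3)
      using nz by (intro eq_matI) auto
  qed
  have inv': "(\<Sum>l<r. C $$ (k, l) * U (s l) (t j)) = (if k = j then 1 else 0)" if "k < r" "j < r" for k j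
  proof -
    have "(C * kernel_mat U s t r) $$ (k, j) = (\<Sum>l<r. C $$ (k, l) * U (s l) (t j))"
      using that C by (auto simp: kernel_mat_def scalar_prod_def atLeast0LessThan intro!: sum.cong)
    then show ?thesis using inv that by simp
  qed
  have "U a b = (\<Sum>k<r. \<Sum>l<r. U a (t k) * C $$ (k, l) * U (s l) b)" for a b
  proof -
    obtain v m where m: "m < Suc r" "v m \<noteq> 0"
      and v: "\<And>i. i < Suc r \<Longrightarrow> (\<Sum>j<Suc r. U ((s(r := a)) i) ((t(r := b)) j) * v j) = 0"
      using sing[of "s(r := a)" "t(r := b)"] unfolding det_kernel_mat_eq_0_iff by blast
    have upd: "(\<Sum>j<r. U x ((t(r := b)) j) * v j) = (\<Sum>j<r. U x (t j) * v j)" for x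
      by (intro sum.cong) auto
    have row: "(\<Sum>j<r. U (s i) (t j) * v j) + U (s i) b * v r = 0" if "i < r" for i
      using v[of i] that unfolding sum.lessThan_Suc upd by simp
    have last: "(\<Sum>j<r. U a (t j) * v j) + U a b * v r = 0"
      using v[of r] unfolding sum.lessThan_Suc upd by simp
    have vr: "v r \<noteq> 0"
    proof
      assume 0: "v r = 0"
      then have "m < r" using m by (cases "m = r") auto
      then have "\<exists>c. (\<exists>j<r. c j \<noteq> 0) \<and> (\<forall>i<r. (\<Sum>j<r. U (s i) (t j) * c j) = 0)"
        using row 0 m by (intro exI[of _ v]) auto
      then show False using nz unfolding det_kernel_mat_eq_0_iff by blast
    qed
    define w where "w j = - v j / v r" for j
    have row': "U (s i) b = (\<Sum>j<r. U (s i) (t j) * w j)" if "i < r" for i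
    proof -
      have "(\<Sum>j<r. U (s i) (t j) * w j) = - (\<Sum>j<r. U (s i) (t j) * v j) / v r"
        unfolding w_def by (simp add: sum_divide_distrib sum_negf)
      then show ?thesis using row[OF that] vr by (simp add: field_simps add_eq_0_iff)
    qed
    have last': "U a b = (\<Sum>j<r. U a (t j) * w j)"
    proof -
      have "(\<Sum>j<r. U a (t j) * w j) = - (\<Sum>j<r. U a (t j) * v j) / v r"
        unfolding w_def by (simp add: sum_divide_distrib sum_negf)
      then show ?thesis using last vr by (simp add: field_simps add_eq_0_iff)
    qed
    have w: "w k = (\<Sum>l<r. C $$ (k, l) * U (s l) b)" if "k < r" for k
    proof -
      have "(\<Sum>l<r. C $$ (k, l) * U (s l) b) = (\<Sum>l<r. \<Sum>j<r. C $$ (k, l) * U (s l) (t j) * w j)"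
        by (intro sum.cong refl) (simp add: row' sum_distrib_left mult.assoc)
      also have "\<dots> = (\<Sum>j<r. (\<Sum>l<r. C $$ (k, l) * U (s l) (t j)) * w j)"
        by (subst sum.swap) (simp add: sum_distrib_right)
      also have "\<dots> = (\<Sum>j<r. if k = j then w j else 0)"
        using that by (intro sum.cong) (auto simp: inv')
      finally show ?thesis using that by simp
    qed
    show ?thesis
      unfolding last' by (intro sum.cong refl) (simp add: w sum_distrib_left mult.assoc)
  qed
  with C that show ?thesis by blast
qed

text \<open>
  Under such a factorization every minor of order \<open>r\<close> splits into a factor that depends only on its
  rows and one that depends only on its columns.
\<close>

lemma det_kernel_mat_product:
  assumes C: "C \<in> carrier_mat r r"
    and U: "\<And>a b. U a b = (\<Sum>k<r. \<Sum>l<r. U a (t k) * C $$ (k, l) * U (s l) b)"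
  shows "det (kernel_mat U s' t' r) = det (kernel_mat U s' t r) * det C * det (kernel_mat U s t' r)"
proof -
  have "kernel_mat U s' t' r = kernel_mat U s' t r * (C * kernel_mat U s t' r)"
    using C
    by (intro eq_matI)
       (auto simp: kernel_mat_def scalar_prod_def atLeast0LessThan U[of "s' i" "t' j" for i j]
          sum_distrib_left mult.assoc intro!: sum.cong)
  then show ?thesis
    using C by (simp add: det_mult[of _ r])
qed

lemma norm_det_kernel_mat_le:
  assumes "\<And>i j. i < n \<Longrightarrow> j < n \<Longrightarrow> norm (U (s i) (t j)) \<le> K"
  shows "norm (det (kernel_mat U s t n)) \<le> fact n * K ^ n"
proof -
  have "norm (signof p * (\<Prod>i = 0..<n. U (s i) (t (p i)))) \<le> K ^ n" if "p permutes {0..<n}" for p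
  proof -
    have "norm (\<Prod>i = 0..<n. U (s i) (t (p i))) \<le> (\<Prod>i = 0..<n. K)"
      unfolding prod_norm[symmetric]
      using assms that by (intro prod_mono) (auto dest: permutes_less_bound)
    then show ?thesis by (simp add: norm_mult sign_def)
  qed
  then have "norm (det (kernel_mat U s t n)) \<le> (\<Sum>p\<in>{p. p permutes {0..<n}}. K ^ n)"
    unfolding det_kernel_mat by (intro sum_norm_le) auto
  then show ?thesis
    by (simp add: card_permutations)
qed

lemma tendsto_det_kernel_mat:
  assumes "\<And>i j. i < n \<Longrightarrow> j < n \<Longrightarrow> ((\<lambda>x. V x (s x i) (t x j)) \<longlongrightarrow> U (s' i) (t' j)) F"
  shows "((\<lambda>x. det (kernel_mat (V x) (s x) (t x) n)) \<longlongrightarrow> det (kernel_mat U s' t' n)) F"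
  unfolding det_kernel_mat
  using assms by (intro tendsto_sum tendsto_mult tendsto_prod tendsto_const) (auto dest: permutes_less_bound)

lemma holomorphic_det_kernel_mat:
  assumes "\<And>i j. i < n \<Longrightarrow> j < n \<Longrightarrow> (\<lambda>x. U (s x i) (t x j)) holomorphic_on S"
  shows "(\<lambda>x. det (kernel_mat U (s x) (t x) n)) holomorphic_on S"
  unfolding det_kernel_mat
  using assms by (intro holomorphic_intros) (auto dest: permutes_less_bound)


section \<open>The area measure of the disk\<close>

lemma space_dA [simp]: "space dA = ball 0 1"
  by (simp add: dA_def)

lemma sets_dA_iff: "A \<in> sets dA \<longleftrightarrow> A \<in> sets lebesgue \<and> A \<subseteq> ball 0 1"
  by (auto simp: dA_def sets_restrict_space_iff)

lemma emeasure_dA: "A \<in> sets dA \<Longrightarrow> emeasure dA A = ennreal (1 / pi) * emeasure lebesgue A"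
  unfolding sets_dA_iff
  by (auto simp: dA_def emeasure_density_const sets_restrict_space_iff emeasure_restrict_space)

lemma emeasure_dA_ball: "0 \<le> r \<Longrightarrow> r \<le> 1 \<Longrightarrow> emeasure dA (ball 0 r) = ennreal (r\<^sup>2)"
proof -
  assume r: "0 \<le> r" "r \<le> 1"
  then have "ball 0 r \<in> sets dA" by (auto simp: sets_dA_iff)
  then have "emeasure dA (ball 0 r) = ennreal (1 / pi) * ennreal (pi * r\<^sup>2)"
    by (subst emeasure_dA) (auto simp: emeasure_ball unit_ball_vol_2 r)
  also have "\<dots> = ennreal (r\<^sup>2)" by (subst ennreal_mult[symmetric]) auto
  finally show ?thesis .
qed

interpretation dA: finite_measure dA
  by standard (use emeasure_dA_ball[of 1] in simp)

lemma AE_dA_iff: "(AE z in dA. P z) \<longleftrightarrow> (AE z in lebesgue. z \<in> ball 0 1 \<longrightarrow> P z)"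
  unfolding dA_def by (subst AE_density) (auto simp: AE_restrict_space_iff)

lemma measurable_dA_iff: "borel_measurable dA = borel_measurable (lebesgue_on (ball 0 1))"
  unfolding dA_def by (rule measurable_cong_sets) auto

lemma borel_measurable_imp_dA [measurable (raw)]:
  "f \<in> borel_measurable borel \<Longrightarrow> f \<in> borel_measurable dA"
  unfolding measurable_dA_iff
  by (intro measurable_restrict_space1 measurable_completion) (simp add: measurable_lborel2)

lemma AE_dA_not_in_null_set: "A \<in> null_sets lborel \<Longrightarrow> AE z in dA. z \<notin> A"
  unfolding AE_dA_iff by (intro AE_completion AE_I'[of A]) auto

lemma AE_dA_nz: "AE z in dA. z \<noteq> 0"
  using AE_dA_not_in_null_set[of "{0}"] by (simp add: null_sets_def)

text \<open>
  Rotation invariance is transported to the complex plane from the coordinate space \<open>real ^ 2\<close>,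
  where orthogonal maps preserve Lebesgue measure.
\<close>

definition complex_of_vec :: "real^2 \<Rightarrow> complex" where
  "complex_of_vec v = Complex (v $ 1) (v $ 2)"

definition vec_of_complex :: "complex \<Rightarrow> real^2" where
  "vec_of_complex z = vector [Re z, Im z]"

lemma vec_of_complex_inverse [simp]:
  "complex_of_vec (vec_of_complex z) = z" "vec_of_complex (complex_of_vec v) = v"
  by (auto simp: complex_of_vec_def vec_of_complex_def Finite_Cartesian_Product.vec_eq_iff forall_2)

lemma measurable_complex_of_vec [measurable]: "complex_of_vec \<in> borel_measurable borel"
  unfolding complex_of_vec_def complex_eq_iff
  by (intro borel_measurable_continuous_onI) (simp add: Complex_eq, intro continuous_intros)

lemma distr_complex_of_vec: "distr lborel borel complex_of_vec = lborel"
proof (rule lborel_eqI[symmetric])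
  fix l u :: complex
  assume le: "\<And>b. b \<in> Basis \<Longrightarrow> l \<bullet> b \<le> u \<bullet> b"
  have "complex_of_vec -` box l u = box (vec_of_complex l) (vec_of_complex u)"
    by (auto simp: complex_of_vec_def vec_of_complex_def mem_box_cart forall_2 mem_box Basis_complex_def)
  then have "emeasure (distr lborel borel complex_of_vec) (box l u) =
      emeasure lborel (box (vec_of_complex l) (vec_of_complex u))"
    by (subst emeasure_distr) auto
  also have "\<dots> = (\<Prod>b\<in>Basis. (u - l) \<bullet> b)"
    using le[of 1] le[of \<i>]
    by (auto simp: emeasure_lborel_box_eq Basis_vec_def Basis_complex_def UNIV_2 vec_of_complex_def
        axis_eq_axis inner_axis prod.insert_if)
  finally show "emeasure (distr lborel borel complex_of_vec) (box l u) = (\<Prod>b\<in>Basis. (u - l) \<bullet> b)" .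
qed simp

lemma distr_lborel_mult_unimodular:
  fixes c :: complex
  assumes c: "norm c = 1"
  shows "distr lborel borel ((*) c) = lborel"
proof (rule lborel_eqI[symmetric])
  fix l u :: complex
  assume le: "\<And>b. b \<in> Basis \<Longrightarrow> l \<bullet> b \<le> u \<bullet> b"
  \<comment> \<open>the preimage of a box under \<open>z \<mapsto> c z\<close> is its image under the inverse rotation\<close>
  define f where "f v = vec_of_complex (cnj c * complex_of_vec v)" for v
  have cc: "c * cnj c = 1"
    using c by (simp add: complex_norm_square[symmetric])
  have f_eq: "f v = vector [Re c * v $ 1 + Im c * v $ 2, Re c * v $ 2 - Im c * v $ 1]" for v
    by (simp add: f_def vec_of_complex_def complex_of_vec_def)
  have "linear f"
    by (rule linearI) (auto simp: f_eq Finite_Cartesian_Product.vec_eq_iff forall_2 algebra_simps)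
  moreover have "norm (f v) = norm v" for v
  proof -
    have brahmagupta: "(a * x + b * y)\<^sup>2 + (a * y - b * x)\<^sup>2 = (a\<^sup>2 + b\<^sup>2) * (x\<^sup>2 + y\<^sup>2)" for a x b y :: real
      by (simp add: power2_eq_square algebra_simps)
    have "(Re c)\<^sup>2 + (Im c)\<^sup>2 = 1" using c by (simp add: cmod_def)
    then have "(Re c * v $ 1 + Im c * v $ 2)\<^sup>2 + (Re c * v $ 2 - Im c * v $ 1)\<^sup>2 = (v $ 1)\<^sup>2 + (v $ 2)\<^sup>2"
      using brahmagupta[of "Re c" "v $ 1" "Im c" "v $ 2"] by simp
    then show ?thesis by (simp add: norm_vec_def L2_set_def sum_2 f_eq)
  qed
  ultimately have orth: "orthogonal_transformation f"
    by (simp add: orthogonal_transformation)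
  let ?B = "complex_of_vec -` box l u"
  have B: "?B = box (vec_of_complex l) (vec_of_complex u)"
    by (auto simp: complex_of_vec_def vec_of_complex_def mem_box_cart forall_2 mem_box Basis_complex_def)
  have lm: "?B \<in> lmeasurable" unfolding B by simp
  have im: "f ` ?B = complex_of_vec -` ((*) c -` box l u)"
  proof (rule equalityI; rule subsetI)
    fix v assume "v \<in> f ` ?B"
    then show "v \<in> complex_of_vec -` ((*) c -` box l u)"
      using cc by (auto simp: f_def mult.assoc[symmetric])
  next
    fix v assume v: "v \<in> complex_of_vec -` ((*) c -` box l u)"
    then have "v = f (vec_of_complex (c * complex_of_vec v))"
      using cc by (simp add: f_def mult.assoc[symmetric] mult.commute[of "cnj c"])
    then show "v \<in> f ` ?B" using v by (metis imageI vec_of_complex_inverse(1) vimageD vimageI2)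
  qed
  have [measurable]: "(*) c \<in> borel_measurable borel" by simp
  have "emeasure (distr lborel borel ((*) c)) (box l u) = emeasure lborel ((*) c -` box l u)"
    by (subst emeasure_distr) auto
  also have "\<dots> = emeasure (distr lborel borel complex_of_vec) ((*) c -` box l u)"
    by (simp add: distr_complex_of_vec)
  also have "\<dots> = emeasure lborel (f ` ?B)"
    unfolding im by (subst emeasure_distr) (auto intro: measurable_sets_borel[OF _ borel_open])
  also have "\<dots> = emeasure lebesgue (f ` ?B)"
  proof -
    have "complex_of_vec -` ((*) c -` box l u) \<in> sets borel"
      by (intro measurable_sets_borel[OF measurable_complex_of_vec] measurable_sets_borel[of "(*) c" borel]) auto
    then show ?thesis unfolding im by simp
  qed
  also have "\<dots> = emeasure lebesgue ?B"
    using measurable_orthogonal_image[OF orth lm] measure_orthogonal_image[OF orth lm] lm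
    by (simp add: emeasure_eq_measure2)
  also have "\<dots> = emeasure (distr lborel borel complex_of_vec) (box l u)"
    unfolding B by (subst emeasure_distr) (auto simp: B)
  also have "\<dots> = (\<Prod>b\<in>Basis. (u - l) \<bullet> b)"
    using le by (simp add: distr_complex_of_vec emeasure_lborel_box_eq)
  finally show "emeasure (distr lborel borel ((*) c)) (box l u) = (\<Prod>b\<in>Basis. (u - l) \<bullet> b)" .
qed simp

lemma distr_lebesgue_mult_unimodular:
  fixes c :: complex
  assumes c: "norm c = 1"
  shows "(*) c \<in> lebesgue \<rightarrow>\<^sub>M lebesgue" "distr lebesgue lebesgue ((*) c) = lebesgue"
proof -
  have m[measurable]: "(*) c \<in> borel_measurable borel" by simp
  have d: "distr lebesgue lborel ((*) c) = lborel"
    using distr_lborel_mult_unimodular[OF c]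
    by (simp add: distr_completion cong: distr_cong)
  show "(*) c \<in> lebesgue \<rightarrow>\<^sub>M lebesgue"
    by (intro completion.measurable_completion2) (auto simp: d measurable_completion)
  show "distr lebesgue lebesgue ((*) c) = lebesgue"
    using completion.completion_distr_eq[of "(*) c" lborel lborel] d by (simp add: measurable_completion)
qed

lemma distr_dA_mult_unimodular:
  fixes c :: complex
  assumes c: "norm c = 1"
  shows measurable_dA_mult_unimodular: "(*) c \<in> dA \<rightarrow>\<^sub>M dA"
    and "distr dA dA ((*) c) = dA"
proof -
  note leb = distr_lebesgue_mult_unimodular[OF c]
  have pre: "(*) c -` A \<inter> space dA = (*) c -` A" if "A \<subseteq> ball 0 1" for A
    using that c by (force simp: norm_mult)
  have sets: "(*) c -` A \<in> sets dA" if "A \<in> sets dA" for A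
    using measurable_sets[OF leb(1), of A] that c by (force simp: sets_dA_iff norm_mult)
  show m: "(*) c \<in> dA \<rightarrow>\<^sub>M dA"
  proof (rule measurableI)
    show "(*) c -` A \<inter> space dA \<in> sets dA" if "A \<in> sets dA" for A
      using that sets[OF that] pre[of A] by (simp add: sets_dA_iff)
  qed (use c in \<open>auto simp: norm_mult\<close>)
  show "distr dA dA ((*) c) = dA"
  proof (rule measure_eqI)
    fix A assume "A \<in> sets (distr dA dA ((*) c))"
    then have A: "A \<in> sets dA" "A \<in> sets lebesgue" "A \<subseteq> ball 0 1" by (auto simp: sets_dA_iff)
    have "emeasure (distr dA dA ((*) c)) A = ennreal (1 / pi) * emeasure lebesgue ((*) c -` A)"
      using A pre[of A] by (simp add: emeasure_distr[OF m] emeasure_dA[OF sets])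
    also have "emeasure lebesgue ((*) c -` A) = emeasure (distr lebesgue lebesgue ((*) c)) A"
      using A by (simp add: emeasure_distr[OF leb(1)])
    finally show "emeasure (distr dA dA ((*) c)) A = emeasure dA A"
      using A by (simp add: emeasure_dA leb(2))
  qed simp
qed

lemma integrable_dA_rotate:
  fixes f :: "complex \<Rightarrow> complex"
  assumes "norm c = 1" "integrable dA f"
  shows "integrable dA (\<lambda>z. f (c * z))"
  using assms distr_dA_mult_unimodular[OF assms(1)] integrable_distr[of "(*) c" dA dA f] by simp

lemma integral_dA_rotate:
  fixes f :: "complex \<Rightarrow> complex"
  assumes "norm c = 1" "f \<in> borel_measurable dA"
  shows "(\<integral>z. f (c * z) \<partial>dA) = (\<integral>z. f z \<partial>dA)"
  using assms distr_dA_mult_unimodular[OF assms(1)] integral_distr[of "(*) c" dA dA f] by simp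

lemma AE_dA_rotate:
  assumes "norm c = 1" "AE z in dA. P z"
  shows "AE z in dA. P (c * z)"
proof -
  from assms(2) obtain N where N: "{z \<in> space dA. \<not> P z} \<subseteq> N" "N \<in> null_sets dA"
    by (auto simp: eventually_ae_filter)
  note m = measurable_dA_mult_unimodular[OF assms(1)]
  have "emeasure dA ((*) c -` N \<inter> space dA) = emeasure (distr dA dA ((*) c)) N"
    using N by (subst emeasure_distr[OF m]) auto
  also have "\<dots> = 0" using N distr_dA_mult_unimodular[OF assms(1)] by auto
  finally have "(*) c -` N \<inter> space dA \<in> null_sets dA"
    using measurable_sets[OF m, of N] N by auto
  moreover have "{z \<in> space dA. \<not> P (c * z)} \<subseteq> (*) c -` N \<inter> space dA"
    using assms(1) by (auto simp: norm_mult intro!: subsetD[OF N(1)])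
  ultimately show ?thesis by (rule AE_I')
qed

text \<open>
  Polar coordinates are avoided altogether. The angular variable is handled by rotation invariance
  alone, and for the radial variable it is enough to know the distribution of \<open>norm z\<close>, which
  follows from the area of disks.
\<close>

lemma distr_dA_norm:
  "distr dA borel norm = density lborel (\<lambda>r. ennreal (2 * r) * indicator {0<..<1} r)" (is "_ = ?N")
proof (rule measure_eqI_lessThan)
  have m [measurable]: "norm \<in> borel_measurable dA" by (rule borel_measurable_imp_dA) simp
  have N: "emeasure ?N {x<..} = ennreal (1 - x\<^sup>2)" if "0 \<le> x" "x \<le> 1" for x :: real
  proof -
    have "AE r in lborel. r \<noteq> 1" "AE r in lborel. r \<noteq> x"
      by (rule AE_lborel_singleton)+
    then have "AE r in lborel. ennreal (2 * r) * indicator {0<..<1} r * indicator {x<..} r =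
        ennreal (2 * r) * indicator {x..1} r"
      by eventually_elim (use that in \<open>auto simp: indicator_def\<close>)
    then have "emeasure ?N {x<..} = (\<integral>\<^sup>+r. ennreal (2 * r) * indicator {x..1} r \<partial>lborel)"
      by (subst emeasure_density) (auto intro!: nn_integral_cong_AE)
    also have "\<dots> = ennreal (1\<^sup>2 - x\<^sup>2)"
      by (rule nn_integral_FTC_Icc) (use that in \<open>auto intro!: derivative_eq_intros\<close>)
    finally show ?thesis by simp
  qed
  have D: "emeasure (distr dA borel norm) {x<..} = ennreal (1 - x\<^sup>2)" if "0 \<le> x" "x \<le> 1" for x :: real
  proof -
    have null: "AE z in dA. norm z \<noteq> x"
      using AE_dA_not_in_null_set[of "sphere 0 x"] negligible_sphere[of "0::complex" x]
      by (auto simp: negligible_iff_null_sets null_sets_completion_iff)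
    have "emeasure (distr dA borel norm) {x<..} = emeasure dA (norm -` {x<..} \<inter> space dA)"
      by (rule emeasure_distr) auto
    also have "\<dots> = emeasure dA (ball 0 1 - ball 0 x)"
      by (rule emeasure_eq_AE)
         (use null measurable_sets[OF m, of "{x<..}"] in \<open>auto simp: sets_dA_iff\<close>)
    also have "\<dots> = emeasure dA (ball 0 1) - emeasure dA (ball 0 x)"
      using that by (intro emeasure_Diff) (auto simp: sets_dA_iff emeasure_dA_ball)
    also have "\<dots> = ennreal (1 - x\<^sup>2)"
      using that by (simp add: emeasure_dA_ball ennreal_minus flip: ennreal_1)
    finally show ?thesis .
  qed
  show "emeasure (distr dA borel norm) {x<..} = emeasure ?N {x<..}" for x
  proof -
    consider "x < 0" | "0 \<le> x" "x \<le> 1" | "x > 1" by linarith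
    then show ?thesis
    proof cases
      case 1
      have "emeasure (distr dA borel norm) {x<..} = emeasure (distr dA borel norm) {0<..}"
      proof -
        have "emeasure dA (norm -` {x<..} \<inter> space dA) = emeasure dA (norm -` {0<..} \<inter> space dA)"
        proof (rule emeasure_eq_AE)
          show "AE z in dA. z \<in> norm -` {x<..} \<inter> space dA \<longleftrightarrow> z \<in> norm -` {0<..} \<inter> space dA"
            using AE_dA_nz by eventually_elim (use 1 in \<open>auto intro: less_le_trans\<close>)
        qed (rule measurable_sets[OF m], simp)+
        then show ?thesis by (simp add: emeasure_distr)
      qed
      moreover have "emeasure ?N {x<..} = emeasure ?N {0<..}"
        using 1 by (subst (1 2) emeasure_density) (auto intro!: nn_integral_cong simp: indicator_def)
      ultimately show ?thesis using N[of 0] D[of 0] by simp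
    next
      case 2 then show ?thesis using N D by simp
    next
      case 3
      then have "norm -` {x<..} \<inter> space dA = {}" by auto
      moreover have "(\<lambda>r. ennreal (2 * r) * indicator {0<..<1} r * indicator {x<..} r) = (\<lambda>r. 0)"
        using 3 by (auto split: split_indicator)
      then have "emeasure ?N {x<..} = 0"
        by (subst emeasure_density) auto
      ultimately show ?thesis by (simp add: emeasure_distr)
    qed
  qed
  show "emeasure (distr dA borel norm) {x<..} < \<infinity>" for x
    by (simp add: emeasure_distr dA.emeasure_finite less_top[symmetric])
qed auto

lemma AE_dA_norm:
  assumes "AE r in unit_interval_measure. P r"
  shows "AE z in dA. P (norm z)"
proof -
  have "AE r in lborel. r \<in> {0<..<1} \<longrightarrow> P r"
    using assms by (simp add: AE_restrict_space_iff AE_completion_iff)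
  then have "AE r in distr dA borel norm. P r"
    unfolding distr_dA_norm by (subst AE_density) (auto simp: indicator_def)
  then show ?thesis
    by (rule AE_distrD[rotated]) (rule borel_measurable_imp_dA, simp)
qed

lemma completion_ex_borel_measurable_complex:
  fixes g :: "real \<Rightarrow> complex"
  assumes "g \<in> borel_measurable unit_interval_measure"
  obtains g' where "g' \<in> borel_measurable borel" "AE r in unit_interval_measure. g r = g' r"
proof -
  let ?h = "\<lambda>r. if r \<in> {0<..<1} then g r else 0"
  have h: "?h \<in> borel_measurable lebesgue"
    using assms by (rule borel_measurable_if_I) auto
  have "(\<lambda>r. Re (?h r)) \<in> borel_measurable lebesgue" "(\<lambda>r. Im (?h r)) \<in> borel_measurable lebesgue"
    using h by measurable
  from this[THEN completion_ex_borel_measurable_real]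
  obtain u v where uv: "u \<in> borel_measurable lborel" "v \<in> borel_measurable lborel"
      "AE r in lborel. Re (?h r) = u r" "AE r in lborel. Im (?h r) = v r"
    by blast
  show ?thesis
  proof
    show "(\<lambda>r. Complex (u r) (v r)) \<in> borel_measurable borel"
      using uv(1,2) by (simp add: Complex_eq)
    show "AE r in unit_interval_measure. g r = Complex (u r) (v r)"
      using uv(3,4) by (auto simp: AE_restrict_space_iff AE_completion_iff complex_eq_iff)
  qed
qed

lemma borel_measurable_AE_dA:
  fixes f g :: "complex \<Rightarrow> complex"
  assumes "f \<in> borel_measurable dA" "AE z in dA. f z = g z"
  shows "g \<in> borel_measurable dA"
proof -
  have "(\<lambda>z. if z \<in> ball 0 1 then f z else 0) \<in> borel_measurable lebesgue"
    using assms(1) unfolding measurable_dA_iff by (rule borel_measurable_if_I) auto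
  moreover have "AE z in lebesgue. (if z \<in> ball 0 1 then f z else 0) = (if z \<in> ball 0 1 then g z else 0)"
    using assms(2) unfolding AE_dA_iff by eventually_elim auto
  ultimately have "(\<lambda>z. if z \<in> ball 0 1 then g z else 0) \<in> borel_measurable lebesgue"
    by (rule borel_measurable_AE)
  then show ?thesis
    unfolding measurable_dA_iff by (rule borel_measurable_if_D)
qed

text \<open>
  A Lebesgue measurable profile is replaced by a Borel measurable one; this is harmless because
  \<open>norm\<close> pulls null sets back to null sets (\<open>AE_dA_norm\<close>).
\<close>

lemma radial_integral:
  fixes g :: "real \<Rightarrow> complex"
  assumes g: "g \<in> borel_measurable unit_interval_measure"
  shows measurable_dA_norm: "(\<lambda>z. g (norm z)) \<in> borel_measurable dA"
    and integrable_dA_norm_iff: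
      "integrable dA (\<lambda>z. g (norm z)) \<longleftrightarrow> integrable unit_interval_measure (\<lambda>r. g r * of_real r)"
    and integral_dA_norm:
      "(\<integral>z. g (norm z) \<partial>dA) = 2 * (\<integral>r. g r * of_real r \<partial>unit_interval_measure)"
proof -
  obtain g' where g' [measurable]: "g' \<in> borel_measurable borel"
    and eq: "AE r in unit_interval_measure. g r = g' r"
    using completion_ex_borel_measurable_complex[OF g] by blast
  have m [measurable]: "norm \<in> borel_measurable dA" by (rule borel_measurable_imp_dA) simp
  have ae: "AE z in dA. g' (norm z) = g (norm z)"
    using AE_dA_norm[OF eq] by auto
  show meas: "(\<lambda>z. g (norm z)) \<in> borel_measurable dA"
    by (rule borel_measurable_AE_dA[OF _ ae]) measurable
  have mU [measurable]: "g' \<in> borel_measurable unit_interval_measure"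
      "(of_real :: real \<Rightarrow> complex) \<in> borel_measurable unit_interval_measure"
    by (auto intro!: measurable_restrict_space1 measurable_completion)
  have eqU: "AE r in unit_interval_measure. g' r * of_real r = g r * of_real r"
    using eq by eventually_elim simp
  have scale: "(2 * r) *\<^sub>R g' r = 2 * (g' r * of_real r)" for r
    by (simp add: scaleR_conv_of_real)
  have w: "ennreal (2 * r) * indicator {0<..<1} r = ennreal (2 * r * indicator {0<..<1} r)" for r :: real
    by (auto simp: indicator_def)
  have "integrable dA (\<lambda>z. g (norm z)) \<longleftrightarrow> integrable dA (\<lambda>z. g' (norm z))"
    using meas ae by (intro integrable_cong_AE) auto
  also have "\<dots> \<longleftrightarrow> integrable (distr dA borel norm) g'"
    by (subst integrable_distr_eq) auto
  also have "\<dots> \<longleftrightarrow> integrable lborel (\<lambda>r. (2 * r * indicator {0<..<1} r) *\<^sub>R g' r)"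
    unfolding distr_dA_norm w by (subst integrable_density) (auto simp: indicator_def)
  also have "\<dots> \<longleftrightarrow> integrable unit_interval_measure (\<lambda>r. (2 * r) *\<^sub>R g' r)"
    by (subst integrable_restrict_space)
       (auto simp: integrable_completion set_integrable_def mult_ac intro!: arg_cong2[where f=integrable])
  also have "\<dots> \<longleftrightarrow> integrable unit_interval_measure (\<lambda>r. g' r * of_real r)"
  proof
    assume "integrable unit_interval_measure (\<lambda>r. (2 * r) *\<^sub>R g' r)"
    then have "integrable unit_interval_measure (\<lambda>r. 1 / 2 * ((2 * r) *\<^sub>R g' r))"
      by (rule integrable_mult_right)
    then show "integrable unit_interval_measure (\<lambda>r. g' r * of_real r)"
      by (simp add: scale)
  qed (unfold scale, rule integrable_mult_right)
  also have "\<dots> \<longleftrightarrow> integrable unit_interval_measure (\<lambda>r. g r * of_real r)"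
    by (rule integrable_cong_AE[OF _ _ eqU]) (use g in measurable)
  finally show "integrable dA (\<lambda>z. g (norm z)) \<longleftrightarrow> integrable unit_interval_measure (\<lambda>r. g r * of_real r)" .
  have "(\<integral>z. g (norm z) \<partial>dA) = (\<integral>z. g' (norm z) \<partial>dA)"
    using meas ae by (intro integral_cong_AE) auto
  also have "\<dots> = (\<integral>r. g' r \<partial>distr dA borel norm)"
    by (subst integral_distr) auto
  also have "\<dots> = (\<integral>r. (2 * r * indicator {0<..<1} r) *\<^sub>R g' r \<partial>lborel)"
    unfolding distr_dA_norm w by (subst integral_density) (auto simp: indicator_def)
  also have "\<dots> = (\<integral>r. (2 * r) *\<^sub>R g' r \<partial>unit_interval_measure)"
    by (subst integral_restrict_space)
       (auto simp: integral_completion set_lebesgue_integral_def mult_ac intro!: Bochner_Integration.integral_cong)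
  also have "\<dots> = 2 * (\<integral>r. g r * of_real r \<partial>unit_interval_measure)"
    unfolding scale integral_mult_right_zero
    by (rule arg_cong[where f = "(*) 2"], rule integral_cong_AE[OF _ _ eqU]) (use g in measurable)
  finally show "(\<integral>z. g (norm z) \<partial>dA) = 2 * (\<integral>r. g r * of_real r \<partial>unit_interval_measure)" .
qed


section \<open>Integrals against an integrable weight\<close>

lemma integrable_dA_mult_bounded:
  fixes v h :: "complex \<Rightarrow> complex"
  assumes v: "integrable dA v" and h: "h \<in> borel_measurable dA"
    and K: "\<And>z. norm z < 1 \<Longrightarrow> norm (h z) \<le> K"
  shows "integrable dA (\<lambda>z. v z * h z)"
    and "norm (\<integral>z. v z * h z \<partial>dA) \<le> K * (\<integral>z. norm (v z) \<partial>dA)"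
proof -
  have le: "norm (v z * h z) \<le> K * norm (v z)" if "norm z < 1" for z
    using mult_right_mono[OF K[OF that], of "norm (v z)"] by (simp add: norm_mult mult.commute)
  have i: "integrable dA (\<lambda>z. K * norm (v z))" using v by simp
  show *: "integrable dA (\<lambda>z. v z * h z)"
    by (rule Bochner_Integration.integrable_bound[OF i])
       (use v h le in \<open>auto intro!: AE_I2 order.trans[OF le]\<close>)
  have "norm (\<integral>z. v z * h z \<partial>dA) \<le> (\<integral>z. norm (v z * h z) \<partial>dA)"
    by (rule integral_norm_bound)
  also have "\<dots> \<le> (\<integral>z. K * norm (v z) \<partial>dA)"
    by (rule integral_mono) (use * i le in auto)
  finally show "norm (\<integral>z. v z * h z \<partial>dA) \<le> K * (\<integral>z. norm (v z) \<partial>dA)" by simp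
qed

lemma dA_dominated_convergence:
  fixes v h :: "complex \<Rightarrow> complex"
  assumes v: "integrable dA v" and h: "h \<in> borel_measurable dA" "\<And>n. hs n \<in> borel_measurable dA"
    and K: "\<And>n z. norm z < 1 \<Longrightarrow> norm (hs n z) \<le> K"
    and lim: "AE z in dA. (\<lambda>n. hs n z) \<longlonglongrightarrow> h z"
  shows "(\<lambda>n. \<integral>z. v z * hs n z \<partial>dA) \<longlonglongrightarrow> (\<integral>z. v z * h z \<partial>dA)"
proof (rule integral_dominated_convergence[where w = "\<lambda>z. K * norm (v z)"])
  show "AE z in dA. (\<lambda>n. v z * hs n z) \<longlonglongrightarrow> v z * h z"
    using lim by eventually_elim (intro tendsto_intros)
  show "AE z in dA. norm (v z * hs n z) \<le> K * norm (v z)" for n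
    using mult_left_mono[OF K norm_ge_zero] by (intro AE_I2) (simp add: norm_mult mult.commute[of K])
qed (use v h in auto)

text \<open>
  Applied below both to the exponential series and to the expansion of the Bergman kernel.
\<close>

lemma dA_integral_sums:
  fixes v :: "complex \<Rightarrow> complex"
  assumes v: "integrable dA v" and h: "\<And>n. hs n \<in> borel_measurable dA"
    and K: "\<And>n z. norm z < 1 \<Longrightarrow> norm (hs n z) \<le> K n" and "summable K"
    and lim: "\<And>z. norm z < 1 \<Longrightarrow> (\<lambda>n. hs n z) sums h z"
  shows "(\<lambda>n. \<integral>z. v z * hs n z \<partial>dA) sums (\<integral>z. v z * h z \<partial>dA)"
proof -
  have K0: "0 \<le> K n" for n by (rule order_trans[OF norm_ge_zero K[of 0 n]]) simp
  have bound: "norm (\<Sum>i<n. hs i z) \<le> suminf K" if "norm z < 1" for n z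
    using sum_norm_le[of "{..<n}" "\<lambda>i. hs i z" K] K[OF that] sum_le_suminf[OF \<open>summable K\<close>, of "{..<n}"] K0
    by (meson finite_lessThan order_trans)
  have hm: "h \<in> borel_measurable dA"
    by (rule borel_measurable_LIMSEQ_metric[where f = "\<lambda>n z. \<Sum>i<n. hs i z"])
       (use h lim in \<open>auto simp: sums_def\<close>)
  have "(\<lambda>n. \<integral>z. v z * (\<Sum>i<n. hs i z) \<partial>dA) \<longlonglongrightarrow> (\<integral>z. v z * h z \<partial>dA)"
    by (rule dA_dominated_convergence[where K = "suminf K"])
       (use v h hm bound lim in \<open>auto simp: sums_def intro!: AE_I2\<close>)
  moreover have "(\<integral>z. v z * (\<Sum>i<n. hs i z) \<partial>dA) = (\<Sum>i<n. \<integral>z. v z * hs i z \<partial>dA)" for n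
    unfolding sum_distrib_left
    by (rule Bochner_Integration.integral_sum) (use integrable_dA_mult_bounded(1)[OF v h K] in auto)
  ultimately show ?thesis by (simp add: sums_def)
qed


section \<open>The exponential transform\<close>

text \<open>
  On the antidiagonal \<open>b = - cnj a\<close> this is the Fourier transform of \<open>v\<close>; off the antidiagonal it is
  the holomorphic extension in two independent variables, and that is what makes Liouville's
  theorem applicable.
\<close>

definition exp_transform :: "(complex \<Rightarrow> complex) \<Rightarrow> complex \<Rightarrow> complex \<Rightarrow> complex" where
  "exp_transform v a b = (\<integral>z. v z * exp (a * z + b * cnj z) \<partial>dA)"

lemma norm_exp_le: "norm z \<le> 1 \<Longrightarrow> norm (exp (a * z + b * cnj z)) \<le> exp (norm a + norm b)" for z :: complex
proof -
  assume z: "norm z \<le> 1"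
  have "norm (exp (a * z + b * cnj z)) \<le> exp (norm (a * z + b * cnj z))" by (rule norm_exp)
  also have "norm (a * z + b * cnj z) \<le> norm (a * z) + norm (b * cnj z)" by (rule norm_triangle_ineq)
  also have "\<dots> \<le> norm a + norm b"
    using mult_left_mono[OF z norm_ge_zero[of a]] mult_left_mono[OF z norm_ge_zero[of b]]
    by (simp add: norm_mult)
  finally show ?thesis by simp
qed

lemma measurable_dA_continuous:
  fixes f :: "complex \<Rightarrow> 'a::{second_countable_topology, topological_space}"
  assumes "continuous_on UNIV f" shows "f \<in> borel_measurable dA"
  using assms by (intro borel_measurable_imp_dA borel_measurable_continuous_onI)

lemma integrable_exp_mult:
  assumes "integrable dA v"
  shows "integrable dA (\<lambda>z. v z * exp (a * z + b * cnj z))"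
  by (rule integrable_dA_mult_bounded(1)[OF assms, where K = "exp (norm a + norm b)"])
     (auto intro!: measurable_dA_continuous continuous_intros norm_exp_le simp del: norm_exp_eq_Re)

text \<open>
  The integral is the sum of a power series in \<open>a\<close> that converges everywhere.
\<close>

lemma holomorphic_exp_integral:
  fixes v q :: "complex \<Rightarrow> complex"
  assumes v: "integrable dA v" and q: "q \<in> borel_measurable dA" "\<And>z. norm z < 1 \<Longrightarrow> norm (q z) \<le> 1"
  shows "(\<lambda>a. \<integral>z. v z * exp (a * q z) \<partial>dA) holomorphic_on UNIV"
proof -
  define c where "c k = (\<integral>z. v z * (q z ^ k / fact k) \<partial>dA)" for k
  have sums: "(\<lambda>k. c k * (a - 0) ^ k) sums (\<integral>z. v z * exp (a * q z) \<partial>dA)" for a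
  proof -
    have "(\<lambda>k. \<integral>z. v z * ((a * q z) ^ k / fact k) \<partial>dA) sums (\<integral>z. v z * exp (a * q z) \<partial>dA)"
    proof (rule dA_integral_sums[OF v])
      show "norm ((a * q z) ^ k / fact k) \<le> norm a ^ k / fact k" if "norm z < 1" for k z
        using power_mono[OF q(2)[OF that], of k]
        by (auto simp: norm_mult norm_power norm_divide power_mult_distrib divide_simps mult_left_le)
      show "summable (\<lambda>k. norm a ^ k / fact k)"
        using summable_exp[of "norm a"] by (simp add: field_simps)
      show "(\<lambda>k. (a * q z) ^ k / fact k) sums exp (a * q z)" for z
        using exp_converges[of "a * q z"] by (simp add: scaleR_conv_of_real field_simps)
    qed (use q in measurable)
    moreover have "(\<integral>z. v z * ((a * q z) ^ k / fact k) \<partial>dA) = c k * (a - 0) ^ k" for k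
      unfolding c_def by (subst integral_mult_left_zero[symmetric]) (simp add: power_mult_distrib mult_ac)
    ultimately show ?thesis by simp
  qed
  have "(\<lambda>a. \<integral>z. v z * exp (a * q z) \<partial>dA) holomorphic_on ball 0 r" for r
    by (rule power_series_holomorphic) (rule sums)
  then have "(\<lambda>a. \<integral>z. v z * exp (a * q z) \<partial>dA) field_differentiable at a" for a
    by (rule holomorphic_on_imp_differentiable_at[where s = "ball 0 (norm a + 1)"]) auto
  then show ?thesis
    by (simp add: holomorphic_on_def field_differentiable_at_within)
qed

lemma exp_transform_split:
  "exp_transform v a b = (\<integral>z. (v z * exp (b * cnj z)) * exp (a * z) \<partial>dA)"
  "exp_transform v a b = (\<integral>z. (v z * exp (a * z)) * exp (b * cnj z) \<partial>dA)"
  by (simp_all add: exp_transform_def exp_add mult_ac)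

lemma holomorphic_exp_transform:
  assumes v: "integrable dA v" and f: "f holomorphic_on UNIV"
  shows "(\<lambda>x. exp_transform v (f x) b) holomorphic_on UNIV"
    and "(\<lambda>x. exp_transform v a (f x)) holomorphic_on UNIV"
proof -
  have "(\<lambda>a. exp_transform v a b) holomorphic_on UNIV"
    unfolding exp_transform_split(1)[abs_def]
    by (rule holomorphic_exp_integral)
       (use integrable_exp_mult[OF v, of 0 b] in \<open>auto intro!: measurable_dA_continuous continuous_intros\<close>)
  then show "(\<lambda>x. exp_transform v (f x) b) holomorphic_on UNIV"
    using holomorphic_on_compose_gen[OF f] by (fastforce simp: o_def)
  have "(\<lambda>b. exp_transform v a b) holomorphic_on UNIV"
    unfolding exp_transform_split(2)[abs_def]
    by (rule holomorphic_exp_integral)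
       (use integrable_exp_mult[OF v, of a 0] in \<open>auto intro!: measurable_dA_continuous continuous_intros\<close>)
  then show "(\<lambda>x. exp_transform v a (f x)) holomorphic_on UNIV"
    using holomorphic_on_compose_gen[OF f] by (fastforce simp: o_def)
qed

text \<open>
  Moving along the antidiagonal from any base point \<open>(s, t)\<close> multiplies the integrand by a unimodular
  character only. Both the boundedness and the decay used later come from this.
\<close>

lemma exp_transform_antidiagonal:
  "exp_transform v (a + s) (- cnj a + t) =
     (\<integral>z. (v z * exp (s * z + t * cnj z)) * cis (2 * Im (a * z)) \<partial>dA)"
proof -
  have "exp ((a + s) * z + (- cnj a + t) * cnj z) = exp (s * z + t * cnj z) * cis (2 * Im (a * z))" for z
  proof -
    have "(a + s) * z + (- cnj a + t) * cnj z = (s * z + t * cnj z) + \<i> * of_real (2 * Im (a * z))"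
      by (simp add: complex_eq_iff algebra_simps)
    then show ?thesis by (simp only: exp_add cis_conv_exp)
  qed
  then show ?thesis by (simp add: exp_transform_def mult_ac)
qed

lemma norm_exp_transform_antidiagonal_le:
  assumes v: "integrable dA v"
  shows "norm (exp_transform v (a + s) (- cnj a + t)) \<le> exp (norm s + norm t) * (\<integral>z. norm (v z) \<partial>dA)"
proof -
  have "norm (\<integral>z. v z * (exp (s * z + t * cnj z) * cis (2 * Im (a * z))) \<partial>dA)
      \<le> exp (norm s + norm t) * (\<integral>z. norm (v z) \<partial>dA)"
    by (rule integrable_dA_mult_bounded(2)[OF v])
       (auto intro!: measurable_dA_continuous continuous_intros norm_exp_le simp: norm_mult simp del: norm_exp_eq_Re)
  then show ?thesis by (simp only: exp_transform_antidiagonal mult.assoc)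
qed


section \<open>Decay of the Fourier transform on average\<close>

lemma cesaro_unimodular:
  fixes w :: complex
  assumes "norm w = 1" "w \<noteq> 1"
  shows "(\<lambda>N. (\<Sum>n<N. w ^ n) / of_nat N) \<longlonglongrightarrow> 0"
proof (rule Lim_null_comparison)
  show "(\<lambda>N. (2 / norm (w - 1)) / real N) \<longlonglongrightarrow> 0"
    by (rule lim_const_over_n)
  show "\<forall>\<^sub>F N in sequentially. norm ((\<Sum>n<N. w ^ n) / of_nat N) \<le> (2 / norm (w - 1)) / real N"
  proof (rule always_eventually, rule allI)
    fix N
    have "norm (w ^ N - 1) \<le> 2"
      using norm_triangle_ineq4[of "w ^ N" 1] assms by (simp add: norm_power)
    then have "norm (\<Sum>n<N. w ^ n) \<le> 2 / norm (w - 1)"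
      using assms(2) by (simp add: geometric_sum norm_divide divide_right_mono)
    then show "norm ((\<Sum>n<N. w ^ n) / of_nat N) \<le> (2 / norm (w - 1)) / real N"
      by (simp add: norm_divide divide_right_mono del: divide_divide_eq_left)
  qed
qed

lemma cis_double_neq_1: "0 < \<bar>t\<bar> \<Longrightarrow> \<bar>t\<bar> < 2 \<Longrightarrow> cis (2 * t) \<noteq> 1"
proof
  assume t: "0 < \<bar>t\<bar>" "\<bar>t\<bar> < 2" and "cis (2 * t) = 1"
  then have "cos (2 * t) = 1" by (metis cis.sel(1) one_complex.sel(1))
  then obtain k :: int where k: "2 * t = of_int k * 2 * pi" by (auto simp: cos_one_2pi_int)
  then have "\<bar>t\<bar> = \<bar>real_of_int k\<bar> * pi" by (simp add: abs_mult)
  with t have "k \<noteq> 0" by auto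
  then have "1 \<le> \<bar>real_of_int k\<bar>" by simp
  then have "pi \<le> \<bar>t\<bar>" using \<open>\<bar>t\<bar> = _\<close> by (simp add: mult_le_cancel_right1)
  with t pi_gt3 show False by linarith
qed

lemma AE_dA_Im_neq: "AE w in dA. Im w \<noteq> y"
proof -
  have "{w :: complex. \<i> \<bullet> w = y} \<in> null_sets lebesgue"
    using negligible_hyperplane[of "\<i>" y] by (simp add: negligible_iff_null_sets)
  then have "AE w in lebesgue. w \<notin> {w. \<i> \<bullet> w = y}"
    by (rule AE_not_in)
  then show ?thesis by (auto simp: AE_dA_iff inner_complex_def)
qed

text \<open>
  The mean of \<open>\<bar>c\<^sub>n\<bar>\<^sup>2\<close> over \<open>n < N\<close> is a double integral of \<open>v(z) cnj (v(w))\<close> against the averaged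
  character \<open>D\<^sub>N(z, w)\<close>, which tends to \<open>0\<close> unless \<open>Im z = Im w\<close>. For fixed \<open>z\<close> the exceptional \<open>w\<close>
  form a line, a null set, so two applications of dominated convergence suffice. Averages of
  squares are preferred to the Riemann-Lebesgue lemma because they need no density argument and
  still make finitely many coefficients small simultaneously.
\<close>

lemma wiener_average:
  assumes v: "integrable dA v"
  shows "(\<lambda>N. (\<Sum>n<N. (norm (\<integral>z. v z * cis (2 * (of_nat n * Im z)) \<partial>dA))\<^sup>2) / real N) \<longlonglongrightarrow> 0"
proof -
  define e where "e n z = cis (2 * (of_nat n * Im z))" for n :: nat and z :: complex
  define c where "c n = (\<integral>z. v z * e n z \<partial>dA)" for n
  define A where "A N z = (\<Sum>n<N. e n z * cnj (c n)) / of_nat N" for N z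
  have em: "e n \<in> borel_measurable dA" for n
    unfolding e_def by (intro measurable_dA_continuous continuous_intros)
  have vi: "integrable dA (\<lambda>z. v z * e n z)" for n
    by (rule integrable_dA_mult_bounded(1)[OF v em, where K = 1]) (simp add: e_def)
  have cv: "integrable dA (\<lambda>w. cnj (v w))" using v by simp
  \<comment> \<open>the Cesaro mean of powers of a unimodular number, different from \<open>1\<close> unless \<open>Im z = Im w\<close>\<close>
  define D where "D N z w = (\<Sum>n<N. cis (2 * (Im z - Im w)) ^ n) / of_nat N" for N :: nat and z w :: complex
  have D_eq: "D N z w = (\<Sum>n<N. e n z * cnj (e n w)) / of_nat N" for N z w
    by (simp add: D_def e_def Complex.DeMoivre cis_mult cis_cnj algebra_simps)
  have Dm: "D N z \<in> borel_measurable dA" for N z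
    unfolding D_def divide_inverse by (intro measurable_dA_continuous continuous_intros)
  have D1: "norm (D N z w) \<le> 1" for N z w
  proof -
    have "norm (\<Sum>n<N. cis (2 * (Im z - Im w)) ^ n) \<le> (\<Sum>n<N. 1)"
      by (rule sum_norm_le) (simp add: norm_power)
    then show ?thesis by (auto simp: D_def norm_divide divide_simps)
  qed
  have A_eq: "A N z = (\<integral>w. cnj (v w) * D N z w \<partial>dA)" for N z
  proof -
    have "(\<integral>w. cnj (v w) * D N z w \<partial>dA) = (\<integral>w. (\<Sum>n<N. (e n z / of_nat N) * cnj (v w * e n w)) \<partial>dA)"
      by (intro Bochner_Integration.integral_cong)
         (auto simp: D_eq sum_distrib_left sum_divide_distrib field_simps)
    also have "\<dots> = (\<Sum>n<N. \<integral>w. (e n z / of_nat N) * cnj (v w * e n w) \<partial>dA)"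
      by (rule Bochner_Integration.integral_sum) (use vi in \<open>auto intro!: integrable_mult_right integrable_cnj simp del: complex_cnj_mult\<close>)
    also have "\<dots> = (\<Sum>n<N. (e n z / of_nat N) * cnj (c n))"
      by (simp add: c_def del: complex_cnj_mult)
    finally show ?thesis by (simp add: A_def sum_divide_distrib)
  qed
  have Am: "A N \<in> borel_measurable dA" for N
    unfolding A_def e_def divide_inverse by (intro measurable_dA_continuous continuous_intros)
  have A_le: "norm (A N z) \<le> 1 * (\<integral>w. norm (cnj (v w)) \<partial>dA)" for N z
    unfolding A_eq by (rule integrable_dA_mult_bounded(2)[OF cv Dm D1])
  have A_lim: "(\<lambda>N. A N z) \<longlonglongrightarrow> 0" if z: "norm z < 1" for z
  proof -
    have "(\<lambda>N. \<integral>w. cnj (v w) * D N z w \<partial>dA) \<longlonglongrightarrow> (\<integral>w. cnj (v w) * 0 \<partial>dA)"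
    proof (rule dA_dominated_convergence[OF cv _ Dm D1])
      have "AE w in dA. norm w < 1" by (rule AE_I2) simp
      with AE_dA_Im_neq[of "Im z"] show "AE w in dA. (\<lambda>N. D N z w) \<longlonglongrightarrow> 0"
      proof eventually_elim
        fix w assume w: "Im w \<noteq> Im z" "norm w < 1"
        then have "0 < \<bar>Im z - Im w\<bar>" "\<bar>Im z - Im w\<bar> < 2"
          using z abs_Im_le_cmod[of z] abs_Im_le_cmod[of w] by linarith+
        then show "(\<lambda>N. D N z w) \<longlonglongrightarrow> 0"
          unfolding D_def by (intro cesaro_unimodular cis_double_neq_1) auto
      qed
    qed simp
    then show ?thesis by (simp add: A_eq)
  qed
  have "(\<lambda>N. \<integral>z. v z * A N z \<partial>dA) \<longlonglongrightarrow> (\<integral>z. v z * 0 \<partial>dA)"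
    by (rule dA_dominated_convergence[OF v _ Am A_le]) (use A_lim in \<open>auto intro!: AE_I2\<close>)
  moreover have "(\<integral>z. v z * A N z \<partial>dA) = of_real ((\<Sum>n<N. (norm (c n))\<^sup>2) / real N)" for N
  proof -
    have "(\<integral>z. v z * A N z \<partial>dA) = (\<integral>z. (\<Sum>n<N. (v z * e n z) * (cnj (c n) / of_nat N)) \<partial>dA)"
      by (intro Bochner_Integration.integral_cong)
         (auto simp: A_def sum_distrib_left sum_divide_distrib field_simps)
    also have "\<dots> = (\<Sum>n<N. \<integral>z. (v z * e n z) * (cnj (c n) / of_nat N) \<partial>dA)"
      by (rule Bochner_Integration.integral_sum) (use vi in \<open>auto intro!: integrable_mult_left\<close>)
    also have "\<dots> = (\<Sum>n<N. c n * (cnj (c n) / of_nat N))"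
      unfolding c_def integral_mult_left_zero ..
    also have "\<dots> = of_real ((\<Sum>n<N. (norm (c n))\<^sup>2) / real N)"
      by (simp add: complex_norm_square sum_divide_distrib del: of_real_power)
    finally show ?thesis .
  qed
  ultimately have "(\<lambda>N. complex_of_real ((\<Sum>n<N. (norm (c n))\<^sup>2) / real N)) \<longlonglongrightarrow> of_real 0"
    by simp
  then show ?thesis
    unfolding tendsto_of_real_iff by (simp add: c_def e_def)
qed


section \<open>Exponential transforms of finite rank\<close>

text \<open>
  The sum over \<open>j, k\<close> of the mean squares tends to \<open>0\<close>, so one of the averaged points makes all the
  entries small at once.
\<close>

lemma exp_transform_small_on_antidiagonal:
  fixes s t :: "nat \<Rightarrow> complex"
  assumes v: "integrable dA v" and "0 < \<epsilon>"
  obtains a where "\<And>j k. j < r \<Longrightarrow> k < r \<Longrightarrow> norm (exp_transform v (a + s j) (- cnj a + t k)) \<le> \<epsilon>"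
proof -
  define u where "u n j k = norm (exp_transform v (of_nat n + s j) (- cnj (of_nat n) + t k))" for n j k
  define S where "S N = (\<Sum>j<r. \<Sum>k<r. (\<Sum>n<N. (u n j k)\<^sup>2) / real N)" for N
  have "(\<lambda>N. (\<Sum>n<N. (u n j k)\<^sup>2) / real N) \<longlonglongrightarrow> 0" for j k
  proof -
    have "u n j k = norm (\<integral>z. (v z * exp (s j * z + t k * cnj z)) * cis (2 * (of_nat n * Im z)) \<partial>dA)" for n
      unfolding u_def exp_transform_antidiagonal by simp
    then show ?thesis
      using wiener_average[OF integrable_exp_mult[OF v, of "s j" "t k"]] by (simp only:)
  qed
  then have "S \<longlonglongrightarrow> (\<Sum>j<r. \<Sum>k<r. 0)"
    unfolding S_def by (intro tendsto_sum)
  then have "eventually (\<lambda>N. S N < \<epsilon>\<^sup>2) sequentially"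
    using \<open>0 < \<epsilon>\<close> by (intro order_tendstoD) auto
  then obtain N where N: "S N < \<epsilon>\<^sup>2" "N > 0"
    using eventually_gt_at_top[of 0] by (metis (mono_tags, lifting) eventually_conj eventually_sequentially le_refl)
  have "\<exists>n<N. (\<Sum>j<r. \<Sum>k<r. (u n j k)\<^sup>2) \<le> \<epsilon>\<^sup>2"
  proof (rule ccontr)
    assume "\<not> ?thesis"
    then have "(\<Sum>n<N. \<epsilon>\<^sup>2) \<le> (\<Sum>n<N. \<Sum>j<r. \<Sum>k<r. (u n j k)\<^sup>2)"
      by (intro sum_mono) (auto simp: not_le intro: less_imp_le)
    also have "\<dots> = (\<Sum>j<r. \<Sum>n<N. \<Sum>k<r. (u n j k)\<^sup>2)"
      by (rule sum.swap)
    also have "\<dots> = (\<Sum>j<r. \<Sum>k<r. \<Sum>n<N. (u n j k)\<^sup>2)"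
      by (intro sum.cong refl sum.swap)
    also have "\<dots> = real N * S N"
      using N(2) by (simp add: S_def sum_divide_distrib[symmetric] sum_distrib_left[symmetric])
    finally show False using N by (simp add: mult_le_cancel_left_pos)
  qed
  then obtain n where n: "(\<Sum>j<r. \<Sum>k<r. (u n j k)\<^sup>2) \<le> \<epsilon>\<^sup>2" by blast
  show thesis
  proof (rule that[of "of_nat n"])
    fix j k assume jk: "j < r" "k < r"
    have "(u n j k)\<^sup>2 \<le> (\<Sum>k<r. (u n j k)\<^sup>2)"
      using jk by (intro member_le_sum) auto
    also have "\<dots> \<le> (\<Sum>j<r. \<Sum>k<r. (u n j k)\<^sup>2)"
      using jk by (intro member_le_sum[where f = "\<lambda>j. \<Sum>k<r. (u n j k)\<^sup>2"]) (auto intro!: sum_nonneg)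
    finally have "(u n j k)\<^sup>2 \<le> \<epsilon>\<^sup>2" using n by linarith
    then show "norm (exp_transform v (of_nat n + s j) (- cnj (of_nat n) + t k)) \<le> \<epsilon>"
      using \<open>0 < \<epsilon>\<close> unfolding u_def[symmetric] by (meson abs_le_square_iff power2_le_imp_le less_imp_le)
  qed
qed

text \<open>
  The heart of the rigidity theorem. With \<open>r\<close> the largest order of a nonvanishing minor, the minor
  \<open>E(a)\<close> obtained by sliding along the antidiagonal has the modulus of the entire function \<open>G\<close>, which
  replaces the antiholomorphic factor of \<open>E\<close> by its complex conjugate. \<open>G\<close> is bounded, hence
  constant, so \<open>E\<close> cannot become small.
\<close>

lemma exp_transform_finite_rank_eq_0:
  assumes v: "integrable dA v"
    and sing: "\<And>s t. det (kernel_mat (exp_transform v) s t R) = 0"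
  shows "exp_transform v a b = 0"
proof (rule ccontr)
  assume nz: "exp_transform v a b \<noteq> 0"
  let ?U = "exp_transform v"
  define m where "m = (LEAST n. \<forall>s t. det (kernel_mat ?U s t n) = 0)"
  have m: "det (kernel_mat ?U s t m) = 0" for s t
    using LeastI[of "\<lambda>n. \<forall>s t. det (kernel_mat ?U s t n) = 0" R] sing unfolding m_def by blast
  have "m \<noteq> 0"
  proof
    assume "m = 0"
    with m have "det (kernel_mat ?U (\<lambda>_. 0) (\<lambda>_. 0) 0) = 0" by blast
    then show False by (simp add: det_kernel_mat)
  qed
  then obtain r where r: "m = Suc r" by (cases m) auto
  then have "\<not> (\<forall>s t. det (kernel_mat ?U s t r) = 0)"
    using not_less_Least[of r "\<lambda>n. \<forall>s t. det (kernel_mat ?U s t n) = 0"] unfolding m_def by simp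
  then obtain s t where st: "det (kernel_mat ?U s t r) \<noteq> 0" by blast
  obtain C where C: "C \<in> carrier_mat r r"
    and fact: "\<And>a b. ?U a b = (\<Sum>k<r. \<Sum>l<r. ?U a (t k) * C $$ (k, l) * ?U (s l) b)"
    by (rule kernel_factorization[OF st m[unfolded r]]) (rule that)
  have "r \<noteq> 0"
    using fact[of a b] nz by (cases r) auto
  define X where "X a = det (kernel_mat ?U (\<lambda>j. a + s j) t r)" for a
  define Y where "Y b = det (kernel_mat ?U s (\<lambda>k. b + t k) r)" for b
  define E where "E a = det (kernel_mat ?U (\<lambda>j. a + s j) (\<lambda>k. - cnj a + t k) r)" for a
  define G where "G a = X a * det C * (cnj \<circ> (\<lambda>b. Y (- b)) \<circ> cnj) a" for a
  have E_eq: "E a = X a * det C * Y (- cnj a)" for a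
    unfolding E_def X_def Y_def by (rule det_kernel_mat_product[where U = "?U", OF C fact])
  have normE: "norm (E a) = norm (G a)" for a
    by (simp add: E_eq G_def norm_mult)
  have "X holomorphic_on UNIV"
    unfolding X_def by (intro holomorphic_det_kernel_mat holomorphic_exp_transform v holomorphic_intros)
  moreover have "(\<lambda>b. Y (- b)) holomorphic_on UNIV"
    unfolding Y_def by (intro holomorphic_det_kernel_mat holomorphic_exp_transform v holomorphic_intros)
  then have "(cnj \<circ> (\<lambda>b. Y (- b)) \<circ> cnj) holomorphic_on UNIV"
    by (intro holomorphic_on_compose_cnj_cnj) (auto intro: holomorphic_on_subset)
  ultimately have "G holomorphic_on UNIV"
    unfolding G_def by (intro holomorphic_intros)
  moreover have "bounded (range G)"
  proof -
    define K where "K = Max ((\<lambda>(j, k). exp (norm (s j) + norm (t k))) ` ({..<r} \<times> {..<r})) * (\<integral>z. norm (v z) \<partial>dA)"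
    have "norm (?U (a + s j) (- cnj a + t k)) \<le> K" if "j < r" "k < r" for a j k
    proof -
      have "exp (norm (s j) + norm (t k)) \<le> Max ((\<lambda>(j, k). exp (norm (s j) + norm (t k))) ` ({..<r} \<times> {..<r}))"
        using that by (intro Max_ge) force+
      then show ?thesis
        unfolding K_def
        using norm_exp_transform_antidiagonal_le[OF v, of a "s j" "t k"]
        by (meson order_trans mult_right_mono Bochner_Integration.integral_nonneg norm_ge_zero)
    qed
    then have "norm (G a) \<le> fact r * K ^ r" for a
      unfolding normE[symmetric] E_def by (rule norm_det_kernel_mat_le)
    then show ?thesis by (auto simp: bounded_iff)
  qed
  ultimately have "G constant_on UNIV"
    by (rule Liouville_theorem)
  then have const: "norm (E a) = norm (E 0)" for a
    unfolding normE constant_on_def by auto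
  have E0: "E 0 \<noteq> 0" using st by (simp add: E_def)
  \<comment> \<open>\<open>\<epsilon> \<le> 1\<close> and \<open>r > 0\<close> give \<open>\<epsilon>^r \<le> \<epsilon>\<close>, so entries of norm at most \<open>\<epsilon>\<close> force a determinant below \<open>norm (E 0)\<close>\<close>
  define \<epsilon> where "\<epsilon> = min 1 (norm (E 0) / (2 * fact r))"
  have "fact r * \<epsilon> \<le> fact r * (norm (E 0) / (2 * fact r))"
    unfolding \<epsilon>_def by (intro mult_left_mono) auto
  also have "\<dots> < norm (E 0)" using E0 by simp
  finally have eps: "0 < \<epsilon>" "\<epsilon> \<le> 1" "fact r * \<epsilon> < norm (E 0)"
    using E0 by (auto simp: \<epsilon>_def)
  obtain a where a: "\<And>j k. j < r \<Longrightarrow> k < r \<Longrightarrow> norm (?U (a + s j) (- cnj a + t k)) \<le> \<epsilon>"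
    by (rule exp_transform_small_on_antidiagonal[OF v eps(1)]) (rule that)
  have "norm (E a) \<le> fact r * \<epsilon> ^ r"
    unfolding E_def by (rule norm_det_kernel_mat_le) (rule a)
  also have "\<dots> \<le> fact r * \<epsilon>"
    using power_decreasing[of 1 r \<epsilon>] eps \<open>r \<noteq> 0\<close> by (intro mult_left_mono) auto
  finally show False using eps(3) const[of a] by simp
qed


section \<open>Uniqueness of the Fourier transform\<close>

text \<open>
  The characters \<open>cis (2 Im (a z))\<close> run through all characters of the plane, so this is the
  vanishing of the Fourier transform.
\<close>

definition fourier_null :: "(complex \<Rightarrow> complex) \<Rightarrow> bool" where
  "fourier_null v \<longleftrightarrow> integrable dA v \<and> (\<forall>a. (\<integral>z. v z * cis (2 * Im (a * z)) \<partial>dA) = 0)"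

text \<open>
  Instead of approximating by trigonometric polynomials, consider all multipliers of the
  space of functions with vanishing Fourier transform. That they form a ring is immediate,
  so Stone-Weierstrass applies once the sines are seen to be multipliers.
\<close>

definition multipliers :: "(complex \<Rightarrow> real) set" where
  "multipliers = {f. continuous_on (cball 0 1) f \<and>
     (\<forall>v. fourier_null v \<longrightarrow> fourier_null (\<lambda>z. v z * of_real (f z)))}"

lemma measurable_dA_continuous_cball:
  assumes "continuous_on (cball 0 1) (f :: complex \<Rightarrow> real)"
  shows "(\<lambda>z. complex_of_real (f z)) \<in> borel_measurable dA"
proof -
  have "continuous_on (ball 0 1) (\<lambda>z. complex_of_real (f z))"
    using assms by (intro continuous_intros) (auto intro: continuous_on_subset)
  then show ?thesis
    unfolding measurable_dA_iff by (rule continuous_imp_measurable_on_sets_lebesgue) auto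
qed

lemma integrable_mult_continuous_cball:
  fixes v :: "complex \<Rightarrow> complex"
  assumes v: "integrable dA v" and f: "continuous_on (cball 0 1) (f :: complex \<Rightarrow> real)"
  shows "integrable dA (\<lambda>z. v z * of_real (f z))"
proof -
  have "bounded (f ` cball 0 1)"
    by (intro compact_imp_bounded compact_continuous_image f) auto
  then obtain K where K: "\<forall>x\<in>f ` cball 0 1. norm x \<le> K"
    unfolding bounded_iff by blast
  show ?thesis
    by (rule integrable_dA_mult_bounded(1)[OF v measurable_dA_continuous_cball[OF f], where K = K])
       (use K in auto)
qed

lemma integrable_mult_cis:
  assumes v: "integrable dA v"
  shows "integrable dA (\<lambda>z. v z * cis (2 * Im (a * z)))"
  by (rule integrable_dA_mult_bounded(1)[OF v, where K = 1])
     (auto intro!: measurable_dA_continuous continuous_intros)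

lemma fourier_null_add:
  assumes "fourier_null u" "fourier_null v" shows "fourier_null (\<lambda>z. u z + v z)"
  using assms integrable_mult_cis unfolding fourier_null_def by (auto simp: distrib_right)

lemma fourier_null_scale:
  assumes "fourier_null u" shows "fourier_null (\<lambda>z. u z * c)"
  using assms unfolding fourier_null_def by (auto simp: mult.assoc mult.commute[of c]) (auto simp: mult.assoc[symmetric])

lemma fourier_null_cis:
  assumes "fourier_null u" shows "fourier_null (\<lambda>z. u z * cis (2 * Im (b * z)))"
proof -
  have "u z * cis (2 * Im (b * z)) * cis (2 * Im (a * z)) = u z * cis (2 * Im ((b + a) * z))" for a z
    by (simp only: mult.assoc cis_mult distrib_right plus_complex.simps distrib_left)
  moreover have "integrable dA (\<lambda>z. u z * cis (2 * Im (b * z)))"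
    using assms integrable_mult_cis unfolding fourier_null_def by blast
  ultimately show ?thesis
    using assms unfolding fourier_null_def by (simp only:) blast
qed

lemma multipliers_ring: "function_ring_on multipliers (cball 0 1)"
proof
  have sin_mult: "(\<lambda>z. sin (2 * Im (b * z))) \<in> multipliers" for b
  proof -
    have "fourier_null (\<lambda>z. v z * complex_of_real (sin (2 * Im (b * z))))" if "fourier_null v" for v
    proof -
      have sin: "complex_of_real (sin x) = cis x * (1 / (2 * \<i>)) + cis (- x) * (- 1 / (2 * \<i>))" for x
        by (simp add: complex_eq_iff)
      have neg: "- (2 * Im (b * z)) = 2 * Im ((- b) * z)" for z
        by simp
      have "v z * complex_of_real (sin (2 * Im (b * z))) =
          v z * cis (2 * Im (b * z)) * (1 / (2 * \<i>)) + v z * cis (2 * Im ((- b) * z)) * (- 1 / (2 * \<i>))" for z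
        unfolding sin neg by (simp only: distrib_left mult.assoc)
      then show ?thesis
        using that by (simp only:) (intro fourier_null_add fourier_null_scale fourier_null_cis)
    qed
    then show ?thesis by (auto simp: multipliers_def intro!: continuous_intros)
  qed
  fix x y :: complex assume xy: "x \<in> cball 0 1" "y \<in> cball 0 1" "x \<noteq> y"
  \<comment> \<open>\<open>b = 1/2\<close> and \<open>b = \<i>/2\<close> give the sines of \<open>Im z\<close> and \<open>Re z\<close>, and \<open>sin\<close> is injective on \<open>[- 1, 1]\<close>\<close>
  have inj: "sin p \<noteq> sin q" if "p \<noteq> q" "\<bar>p\<bar> \<le> 1" "\<bar>q\<bar> \<le> 1" for p q :: real
    using that sin_inj_pi[of p q] pi_gt3 by (auto simp: abs_le_iff)
  show "\<exists>f\<in>multipliers. f x \<noteq> f y"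
  proof (cases "Im x = Im y")
    case False
    then have "sin (2 * Im (1 / 2 * x)) \<noteq> sin (2 * Im (1 / 2 * y))"
      using inj[of "Im x" "Im y"] abs_Im_le_cmod[of x] abs_Im_le_cmod[of y] xy by simp
    then show ?thesis using sin_mult[of "1/2"] by (intro bexI) auto
  next
    case True
    then have "Re x \<noteq> Re y" using xy by (auto simp: complex_eq_iff)
    then have "sin (2 * Im (\<i> / 2 * x)) \<noteq> sin (2 * Im (\<i> / 2 * y))"
      using inj[of "Re x" "Re y"] abs_Re_le_cmod[of x] abs_Re_le_cmod[of y] xy by simp
    then show ?thesis using sin_mult[of "\<i>/2"] by (intro bexI) auto
  qed
next
  fix f g assume "f \<in> multipliers" "g \<in> multipliers"
  then show "(\<lambda>x. f x + g x) \<in> multipliers" "(\<lambda>x. f x * g x) \<in> multipliers"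
    by (auto simp: multipliers_def distrib_left mult.assoc[symmetric] intro!: continuous_intros fourier_null_add)
qed (auto simp: multipliers_def intro!: fourier_null_scale)

lemma fourier_null_integral_continuous:
  assumes v: "fourier_null v" and f: "continuous_on (cball 0 1) f"
  shows "(\<integral>z. v z * of_real (f z) \<partial>dA) = 0"
proof -
  interpret function_ring_on multipliers "cball 0 1" by (rule multipliers_ring)
  have iv: "integrable dA v" using v by (simp add: fourier_null_def)
  have "\<exists>g\<in>multipliers. \<forall>x\<in>cball 0 1. \<bar>f x - g x\<bar> < 1 / real (Suc n)" for n
    by (rule Stone_Weierstrass_basic[OF f]) simp
  then obtain g where g: "\<And>n. g n \<in> multipliers" "\<And>n x. norm x \<le> 1 \<Longrightarrow> \<bar>f x - g n x\<bar> < 1 / real (Suc n)"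
    by (metis dist_0_norm mem_cball)
  have gc: "continuous_on (cball 0 1) (g n)" for n using g(1) by (rule continuous)
  have z: "(\<integral>z. v z * of_real (g n z) \<partial>dA) = 0" for n
  proof -
    have "fourier_null (\<lambda>z. v z * of_real (g n z))" using v g(1)[of n] by (auto simp: multipliers_def)
    then have "(\<integral>z. v z * of_real (g n z) * cis (2 * Im (0 * z)) \<partial>dA) = 0" unfolding fourier_null_def by blast
    then show ?thesis by simp
  qed
  have "(\<lambda>n. \<integral>z. v z * complex_of_real (f z - g n z) \<partial>dA) \<longlonglongrightarrow> (\<integral>z. v z * 0 \<partial>dA)"
  proof (rule dA_dominated_convergence[OF iv])
    show "(\<lambda>z. complex_of_real (f z - g n z)) \<in> borel_measurable dA" for n
      by (intro measurable_dA_continuous_cball continuous_intros f gc)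
    show "norm (complex_of_real (f z - g n z)) \<le> 1" if "norm z < 1" for n z
    proof -
      have "\<bar>f z - g n z\<bar> < 1 / real (Suc n)" using that by (intro g(2)) simp
      also have "\<dots> \<le> 1" by simp
      finally show ?thesis unfolding norm_of_real by simp
    qed
    show "AE z in dA. (\<lambda>n. complex_of_real (f z - g n z)) \<longlonglongrightarrow> 0"
    proof (rule AE_I2)
      fix z assume "z \<in> space dA"
      then have "norm (f z - g n z) \<le> 1 / real (Suc n)" for n using g(2)[of z n] by simp
      then have "(\<lambda>n. f z - g n z) \<longlonglongrightarrow> 0"
        by (intro Lim_null_comparison[OF _ LIMSEQ_Suc[OF lim_const_over_n[of 1]]] always_eventually) auto
      then show "(\<lambda>n. complex_of_real (f z - g n z)) \<longlonglongrightarrow> 0"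
        using tendsto_of_real by fastforce
    qed
  qed auto
  moreover have "(\<integral>z. v z * complex_of_real (f z - g n z) \<partial>dA) = (\<integral>z. v z * of_real (f z) \<partial>dA)" for n
    using z[of n] integrable_mult_continuous_cball[OF iv f] integrable_mult_continuous_cball[OF iv gc, of n]
    by (simp add: right_diff_distrib)
  ultimately show ?thesis
    by (simp add: LIMSEQ_const_iff)
qed

text \<open>
  Testing \<open>v\<close> against continuous functions gives \<open>0\<close>. The conjugate sign of \<open>v\<close> is an almost everywhere
  limit of such functions, which may be truncated to norm at most \<open>1\<close>, so the integral of \<open>\<bar>v\<bar>\<close>
  vanishes as well.
\<close>

lemma fourier_null_AE_0:
  assumes v: "fourier_null v"
  shows "AE z in dA. v z = 0"
proof -
  have iv: "integrable dA v" using v by (simp add: fourier_null_def)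
  define h where "h z = (if z \<in> ball 0 1 then cnj (sgn (v z)) else 0)" for z
  have hm: "h \<in> borel_measurable lebesgue"
    unfolding h_def
  proof (rule borel_measurable_if_I)
    have [measurable]: "v \<in> borel_measurable (lebesgue_on (ball 0 1))"
      using borel_measurable_integrable[OF iv] by (simp add: measurable_dA_iff)
    have "(\<lambda>z. v z / of_real (norm (v z))) \<in> borel_measurable (lebesgue_on (ball 0 1))"
      by measurable
    then have "(\<lambda>z. cnj (v z / of_real (norm (v z)))) \<in> borel_measurable (lebesgue_on (ball 0 1))"
      by (rule measurable_compose) (intro borel_measurable_continuous_onI continuous_intros)
    then show "(\<lambda>z. cnj (sgn (v z))) \<in> borel_measurable (lebesgue_on (ball 0 1))"
      by (simp add: sgn_eq)
  qed auto
  have h1: "norm (h z) \<le> 1" for z by (simp add: h_def norm_sgn)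
  obtain N g where N: "negligible N" and g: "\<And>n. continuous_on UNIV (g n)"
    and lim: "\<And>x. x \<notin> N \<Longrightarrow> (\<lambda>n. g n x) \<longlonglongrightarrow> h x"
    using lebesgue_measurable_imp_measurable_on[OF hm, of UNIV] unfolding measurable_on_def by auto
  \<comment> \<open>radial retraction to the closed unit disk, which supplies the bound for dominated convergence\<close>
  define p :: "complex \<Rightarrow> complex" where "p w = w / of_real (max 1 (norm w))" for w
  have pc: "continuous_on UNIV (\<lambda>z. p (g n z))" for n
    unfolding p_def using g by (intro continuous_intros) auto
  have p1: "norm (p w) \<le> 1" for w by (auto simp: p_def norm_divide divide_simps)
  have ae: "AE z in dA. (\<lambda>n. p (g n z)) \<longlonglongrightarrow> h z"
  proof -
    have "AE z in lebesgue. z \<notin> N"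
      using N by (intro AE_not_in) (simp add: negligible_iff_null_sets)
    then have "AE z in dA. z \<notin> N" by (auto simp: AE_dA_iff)
    then show ?thesis
    proof eventually_elim
      fix z assume "z \<notin> N"
      then have "(\<lambda>n. p (g n z)) \<longlonglongrightarrow> p (h z)"
        unfolding p_def by (intro tendsto_intros lim) auto
      moreover have "p (h z) = h z" using h1[of z] by (simp add: p_def max_absorb1)
      ultimately show "(\<lambda>n. p (g n z)) \<longlonglongrightarrow> h z" by (simp only:)
    qed
  qed
  have "(\<lambda>n. \<integral>z. v z * p (g n z) \<partial>dA) \<longlonglongrightarrow> (\<integral>z. v z * h z \<partial>dA)"
  proof (rule dA_dominated_convergence[OF iv _ _ p1 ae])
    show "h \<in> borel_measurable dA"
      using hm unfolding measurable_dA_iff by (rule measurable_restrict_space1)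
    show "(\<lambda>z. p (g n z)) \<in> borel_measurable dA" for n by (rule measurable_dA_continuous[OF pc])
  qed
  moreover have "(\<integral>z. v z * p (g n z) \<partial>dA) = 0" for n
  proof -
    have c: "continuous_on (cball 0 1) (\<lambda>z. Re (p (g n z)))" "continuous_on (cball 0 1) (\<lambda>z. Im (p (g n z)))"
      using continuous_on_subset[OF pc] by (auto intro!: continuous_intros)
    have "v z * p (g n z) = v z * of_real (Re (p (g n z))) + v z * of_real (Im (p (g n z))) * \<i>" for z
      by (subst complex_eq[of "p (g n z)"]) (simp add: algebra_simps)
    then show ?thesis
      using fourier_null_integral_continuous[OF v c(1)] fourier_null_integral_continuous[OF v c(2)]
        integrable_mult_continuous_cball[OF iv c(1)] integrable_mult_continuous_cball[OF iv c(2)]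
      by simp
  qed
  ultimately have "(\<integral>z. v z * h z \<partial>dA) = 0" by (simp add: LIMSEQ_const_iff)
  moreover have "(\<integral>z. v z * h z \<partial>dA) = (\<integral>z. complex_of_real (norm (v z)) \<partial>dA)"
  proof (rule Bochner_Integration.integral_cong)
    fix z assume "z \<in> space dA"
    then show "v z * h z = complex_of_real (norm (v z))"
      by (cases "v z = 0") (auto simp: h_def sgn_eq complex_norm_square[symmetric] power2_eq_square)
  qed simp
  ultimately have "(\<integral>z. norm (v z) \<partial>dA) = 0" by simp
  then have "AE z in dA. norm (v z) = 0"
    by (subst (asm) integral_nonneg_eq_0_iff_AE) (use iv in auto)
  then show ?thesis by simp
qed


section \<open>Toeplitz operators on bounded functions\<close>

lemma bergman_kernel_bounded:
  fixes z :: complex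
  assumes "norm z < 1" "norm w < 1"
  shows "norm (1 / (1 - cnj w * z)\<^sup>2) \<le> 1 / (1 - norm z)\<^sup>2"
proof -
  have "norm (cnj w * z) \<le> norm z"
    using mult_right_mono[of "norm w" 1 "norm z"] assms by (simp add: norm_mult)
  then have "1 - norm z \<le> norm (1 - cnj w * z)"
    using norm_triangle_ineq2[of 1 "cnj w * z"] by simp
  then show ?thesis
    using assms by (auto simp: norm_divide norm_power intro!: divide_left_mono power_mono mult_pos_pos zero_less_power)
qed

lemma toeplitz_integrable:
  assumes f: "integrable dA f" and h: "h \<in> borel_measurable dA" "\<And>w. norm w < 1 \<Longrightarrow> norm (h w) \<le> K"
    and z: "norm z < 1"
  shows "integrable dA (\<lambda>w. f w * h w / (1 - cnj w * z)\<^sup>2)"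
proof -
  have K: "0 \<le> K" by (rule order_trans[OF norm_ge_zero h(2)[of 0]]) simp
  have "integrable dA (\<lambda>w. f w * (h w * (1 / (1 - cnj w * z)\<^sup>2)))"
  proof (rule integrable_dA_mult_bounded(1)[OF f])
    have "(\<lambda>w. (1 - cnj w * z)\<^sup>2) \<in> borel_measurable dA"
      by (intro measurable_dA_continuous continuous_intros)
    then show "(\<lambda>w. h w * (1 / (1 - cnj w * z)\<^sup>2)) \<in> borel_measurable dA"
      using h(1) by measurable
    show "norm (h w * (1 / (1 - cnj w * z)\<^sup>2)) \<le> K * (1 / (1 - norm z)\<^sup>2)" if "norm w < 1" for w
      unfolding norm_mult by (intro mult_mono h(2) bergman_kernel_bounded that z K) auto
  qed
  then show ?thesis by simp
qed

text \<open>
  The expansion \<open>(1 - x)\<^sup>-\<^sup>2 = \<Sum> (j + 1) x^j\<close> of the kernel reads off the Taylor coefficients of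
  \<open>T\<^sub>f h\<close> as moments of \<open>f h\<close>.
\<close>

lemma toeplitz_series:
  assumes f: "integrable dA f" and h: "h \<in> borel_measurable dA" "\<And>w. norm w < 1 \<Longrightarrow> norm (h w) \<le> K"
    and z: "norm z < 1"
  shows "(\<lambda>j. (of_nat (Suc j) * (\<integral>w. f w * (h w * cnj w ^ j) \<partial>dA)) * z ^ j) sums toeplitz f h z"
proof -
  have K: "0 \<le> K" by (rule order_trans[OF norm_ge_zero h(2)[of 0]]) simp
  have "(\<lambda>j. \<integral>w. f w * (h w * (of_nat (Suc j) * (cnj w * z) ^ j)) \<partial>dA) sums
      (\<integral>w. f w * (h w * (1 / (1 - cnj w * z)\<^sup>2)) \<partial>dA)"
  proof (rule dA_integral_sums[OF f])
    have "(\<lambda>w. of_nat (Suc j) * (cnj w * z) ^ j) \<in> borel_measurable dA" for j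
      by (intro measurable_dA_continuous continuous_intros)
    then show "(\<lambda>w. h w * (of_nat (Suc j) * (cnj w * z) ^ j)) \<in> borel_measurable dA" for j
      using h(1) by (rule borel_measurable_times[rotated])
    show "norm (h w * (of_nat (Suc j) * (cnj w * z) ^ j)) \<le> K * (of_nat (Suc j) * norm z ^ j)"
      if "norm w < 1" for w j
    proof -
      have "norm (cnj w * z) ^ j \<le> norm z ^ j"
        using mult_right_mono[of "norm w" 1 "norm z"] that by (intro power_mono) (auto simp: norm_mult)
      then show ?thesis
        unfolding norm_mult[of "h w"] using that K
        by (intro mult_mono h(2)) (auto simp: norm_mult norm_power mult_left_mono simp del: of_nat_Suc)
    qed
    have "summable (\<lambda>j. of_nat (Suc j) * norm z ^ j)"
      using geometric_deriv_sums[of "norm z"] z by (intro sums_summable) auto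
    then show "summable (\<lambda>j. K * (of_nat (Suc j) * norm z ^ j))"
      by (rule summable_mult)
    show "(\<lambda>j. h w * (of_nat (Suc j) * (cnj w * z) ^ j)) sums (h w * (1 / (1 - cnj w * z)\<^sup>2))"
      if "norm w < 1" for w
    proof (rule sums_mult, rule geometric_deriv_sums)
      have "norm w * norm z \<le> 1 * norm z"
        using that by (intro mult_right_mono) auto
      then show "norm (cnj w * z) < 1" using z by (simp add: norm_mult)
    qed
  qed
  moreover have "(\<integral>w. f w * (h w * (of_nat (Suc j) * (cnj w * z) ^ j)) \<partial>dA) =
      (of_nat (Suc j) * (\<integral>w. f w * (h w * cnj w ^ j) \<partial>dA)) * z ^ j" for j
  proof -
    have "f w * (h w * (of_nat (Suc j) * (cnj w * z) ^ j)) =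
        of_nat (Suc j) * (f w * (h w * cnj w ^ j)) * z ^ j" for w
      by (simp add: power_mult_distrib mult_ac del: of_nat_Suc)
    then show ?thesis by (simp only: integral_mult_left_zero integral_mult_right_zero)
  qed
  ultimately show ?thesis using z by (simp add: toeplitz_def)
qed

lemma toeplitz_off_disk: "\<not> norm z < 1 \<Longrightarrow> toeplitz f h z = 0"
  by (simp add: toeplitz_def)

lemma toeplitz_cong:
  assumes "\<And>w. norm w < 1 \<Longrightarrow> h w = h' w" and "\<And>w. norm w < 1 \<Longrightarrow> f w = f' w"
  shows "toeplitz f h = toeplitz f' h'"
  unfolding toeplitz_def using assms
  by (intro ext if_cong refl Bochner_Integration.integral_cong) auto

lemma toeplitz_cong_AE:
  assumes f: "integrable dA f" "AE w in dA. f w = f' w"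
    and h: "h \<in> borel_measurable dA"
  shows "toeplitz f h = toeplitz f' h"
proof -
  have f'm: "f' \<in> borel_measurable dA"
    using borel_measurable_AE_dA[OF _ f(2)] f(1) by auto
  have eq: "(\<integral>w. f w * h w / (1 - cnj w * z)\<^sup>2 \<partial>dA) = (\<integral>w. f' w * h w / (1 - cnj w * z)\<^sup>2 \<partial>dA)" for z
  proof (rule integral_cong_AE)
    have "(\<lambda>w. (1 - cnj w * z)\<^sup>2) \<in> borel_measurable dA"
      by (intro measurable_dA_continuous continuous_intros)
    then show "(\<lambda>w. f w * h w / (1 - cnj w * z)\<^sup>2) \<in> borel_measurable dA"
      "(\<lambda>w. f' w * h w / (1 - cnj w * z)\<^sup>2) \<in> borel_measurable dA"
      using f h f'm by (auto intro!: borel_measurable_divide borel_measurable_times)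
    show "AE w in dA. f w * h w / (1 - cnj w * z)\<^sup>2 = f' w * h w / (1 - cnj w * z)\<^sup>2"
      using f(2) by eventually_elim simp
  qed
  show ?thesis unfolding toeplitz_def eq ..
qed

lemma toeplitz_sum:
  assumes f: "integrable dA f"
    and h: "\<And>i. i \<in> I \<Longrightarrow> h i \<in> borel_measurable dA"
      "\<And>i w. i \<in> I \<Longrightarrow> norm w < 1 \<Longrightarrow> norm (h i w) \<le> K i"
  shows "toeplitz f (\<lambda>w. \<Sum>i\<in>I. c i * h i w) z = (\<Sum>i\<in>I. c i * toeplitz f (h i) z)"
proof (cases "norm z < 1")
  case True
  have "(\<integral>w. f w * (\<Sum>i\<in>I. c i * h i w) / (1 - cnj w * z)\<^sup>2 \<partial>dA) =
      (\<integral>w. (\<Sum>i\<in>I. c i * (f w * h i w / (1 - cnj w * z)\<^sup>2)) \<partial>dA)"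
    by (intro Bochner_Integration.integral_cong) (auto simp: sum_distrib_left sum_divide_distrib mult_ac)
  also have "\<dots> = (\<Sum>i\<in>I. \<integral>w. c i * (f w * h i w / (1 - cnj w * z)\<^sup>2) \<partial>dA)"
    by (rule Bochner_Integration.integral_sum) (intro integrable_mult_right toeplitz_integrable[OF f h True])
  also have "\<dots> = (\<Sum>i\<in>I. c i * (\<integral>w. f w * h i w / (1 - cnj w * z)\<^sup>2 \<partial>dA))"
    by (simp only: integral_mult_right_zero)
  finally show ?thesis using True by (simp add: toeplitz_def)
qed (simp add: toeplitz_off_disk)

lemma toeplitz_symbol_sum:
  assumes f: "\<And>i. i \<in> I \<Longrightarrow> integrable dA (f i)"
    and h: "h \<in> borel_measurable dA" "\<And>w. norm w < 1 \<Longrightarrow> norm (h w) \<le> K"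
  shows "toeplitz (\<lambda>w. \<Sum>i\<in>I. f i w) h z = (\<Sum>i\<in>I. toeplitz (f i) h z)"
proof (cases "norm z < 1")
  case True
  have "(\<integral>w. (\<Sum>i\<in>I. f i w) * h w / (1 - cnj w * z)\<^sup>2 \<partial>dA) =
      (\<integral>w. (\<Sum>i\<in>I. f i w * h w / (1 - cnj w * z)\<^sup>2) \<partial>dA)"
    by (intro Bochner_Integration.integral_cong) (auto simp: sum_distrib_right sum_divide_distrib)
  also have "\<dots> = (\<Sum>i\<in>I. \<integral>w. f i w * h w / (1 - cnj w * z)\<^sup>2 \<partial>dA)"
    by (rule Bochner_Integration.integral_sum) (rule toeplitz_integrable[OF f h True])
  finally show ?thesis using True by (simp add: toeplitz_def)
qed (simp add: toeplitz_off_disk)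

lemma measurable_dA_power [simp]: "(\<lambda>w. w ^ k) \<in> borel_measurable dA"
  by (intro measurable_dA_continuous continuous_intros)

lemma norm_power_le_1: "norm w < 1 \<Longrightarrow> norm (w ^ k) \<le> (1::real)" for w :: complex
  by (simp add: norm_power power_le_one)

lemma toeplitz_poly:
  assumes "integrable dA f"
  shows "toeplitz f (poly p) z = (\<Sum>i\<le>degree p. coeff p i * toeplitz f (\<lambda>w. w ^ i) z)"
  unfolding poly_altdef[abs_def]
  by (rule toeplitz_sum[OF assms, where K = "\<lambda>_. 1"]) (auto simp: norm_power_le_1)

lemma toeplitz_diff_symbol:
  assumes "integrable dA f" "integrable dA g"
    and h: "h \<in> borel_measurable dA" "\<And>w. norm w < 1 \<Longrightarrow> norm (h w) \<le> K"
  shows "toeplitz (\<lambda>w. f w - g w) h z = toeplitz f h z - toeplitz g h z"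
proof (cases "norm z < 1")
  case True
  then show ?thesis
    using toeplitz_integrable[OF assms(1) h True] toeplitz_integrable[OF assms(2) h True]
    by (simp add: toeplitz_def left_diff_distrib diff_divide_distrib)
qed (simp add: toeplitz_off_disk)


section \<open>Toeplitz operators of finite rank\<close>

lemma toeplitz_eq_0_imp_moments_0:
  assumes f: "integrable dA f" and h: "h \<in> borel_measurable dA" "\<And>w. norm w < 1 \<Longrightarrow> norm (h w) \<le> K"
    and 0: "\<And>z. norm z < 1 \<Longrightarrow> toeplitz f h z = 0"
  shows "(\<integral>w. f w * (h w * cnj w ^ j) \<partial>dA) = 0"
proof -
  let ?c = "\<lambda>j. of_nat (Suc j) * (\<integral>w. f w * (h w * cnj w ^ j) \<partial>dA)"
  have sums: "(\<lambda>j. ?c j * z ^ j) sums 0" if "norm z < 1" for z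
    using toeplitz_series[OF f h that] 0[OF that] by simp
  have "?c j = 0"
  proof (rule ccontr)
    assume nz: "?c j \<noteq> 0"
    have "?c 0 = 0" using sums[of 0] by (simp only: norm_zero zero_less_one powser_sums_zero_iff)
    with nz have "0 < j" by (cases "j = 0") auto
    obtain s where "s > 0" and s: "\<And>z :: complex. z \<in> cball 0 s - {0} \<Longrightarrow> (0::complex) \<noteq> 0"
    proof (rule powser_0_nonzero[where r = 1 and a = ?c and f = "\<lambda>_. 0 :: complex" and \<xi> = 0])
      show "(\<lambda>j. ?c j * (z - 0) ^ j) sums 0" if "norm (z - 0) < 1" for z using sums[of z] that by simp
    qed (use nz \<open>0 < j\<close> in auto)
    then show False
      using s[of "of_real s"] by auto
  qed
  then show ?thesis by (simp del: of_nat_Suc)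
qed

lemma sum_fun_apply: "(\<Sum>i\<in>I. F i) x = (\<Sum>i\<in>I. F i x)"
  for F :: "'i \<Rightarrow> 'a \<Rightarrow> 'b::comm_monoid_add"
  by (induction I rule: infinite_finite_induct) auto

text \<open>
  The family may have repetitions, which the set-based notion of dependence does not see.
\<close>

lemma linear_dependence_in_span:
  assumes "finite B" "\<And>i. i < n \<Longrightarrow> x i \<in> fun_space.span B" "card B < n"
  obtains c i where "i < n" "c i \<noteq> 0" "\<And>z. (\<Sum>i<n. c i * x i z) = 0"
proof (cases "inj_on x {..<n}")
  case False
  then obtain i j where ij: "i < n" "j < n" "i \<noteq> j" "x i = x j" by (auto simp: inj_on_def)
  let ?c = "\<lambda>l. if l = i then 1 else if l = j then - 1 else 0 :: complex"
  have "(\<Sum>l<n. ?c l * x l z) = 0" for z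
  proof -
    have "(\<Sum>l<n. ?c l * x l z) = (\<Sum>l\<in>{i, j}. ?c l * x l z)"
      using ij by (intro sum.mono_neutral_right) auto
    then show ?thesis using ij by simp
  qed
  then show ?thesis using that[of i ?c] ij by auto
next
  case True
  let ?S = "x ` {..<n}"
  have "fun_space.dependent ?S"
  proof (rule ccontr)
    assume "\<not> fun_space.dependent ?S"
    then have "card ?S \<le> card B"
      using fun_space.independent_span_bound[OF assms(1), of ?S] assms(2) by auto
    then show False using assms(3) True by (simp add: card_image)
  qed
  then obtain u v where u: "v \<in> ?S" "u v \<noteq> 0" "(\<Sum>v\<in>?S. fun_scale (u v) v) = 0"
    using fun_space.dependent_finite[of ?S] by auto
  have "(\<Sum>i<n. u (x i) * x i z) = 0" for z
  proof -
    have "(\<Sum>v\<in>A. fun_scale (u v) v) z = (\<Sum>v\<in>A. u v * v z)" for A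
      by (simp add: sum_fun_apply fun_scale_def)
    then have "(\<Sum>v\<in>?S. u v * v z) = (\<Sum>v\<in>?S. fun_scale (u v) v) z" by (rule sym)
    also have "\<dots> = 0" unfolding u(3) by simp
    finally have "(\<Sum>v\<in>?S. u v * v z) = 0" .
    then show ?thesis by (simp add: sum.reindex[OF True])
  qed
  then show ?thesis using that[of _ "\<lambda>i. u (x i)"] u by auto
qed

text \<open>
  Luecking's theorem for integrable symbols. Replacing the exponentials in the transform by their
  Taylor polynomials \<open>e n\<close> turns a minor of the transform into one of the form
  \<open>\<integral> v p\<^sub>i q\<^sub>j\<close> with polynomials \<open>p\<^sub>i\<close> in \<open>w\<close> and \<open>q\<^sub>j\<close> in \<open>cnj w\<close>. If there are more \<open>p\<^sub>i\<close> than
  the dimension allows, a combination of them is annihilated by \<open>T\<^sub>v\<close>, all its moments vanish, and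
  the minor is \<open>0\<close>. Vanishing minors survive the limit, although the combination need not converge.
\<close>

theorem toeplitz_finite_rank_imp_AE_0:
  assumes v: "integrable dA v" and B: "finite B"
    and range: "\<And>k. toeplitz v (\<lambda>w. w ^ k) \<in> fun_space.span B"
  shows "AE z in dA. v z = 0"
proof -
  define e where "e n x = (\<Sum>k<n. x ^ k / fact k)" for n and x :: complex
  define V where "V n s t = (\<integral>w. v w * (e n (s * w) * e n (t * cnj w)) \<partial>dA)" for n s t
  let ?R = "Suc (card B)"
  have e_cont: "continuous_on UNIV (\<lambda>w. e n (s * w))" "continuous_on UNIV (\<lambda>w. e n (s * cnj w))" for n s
    unfolding e_def by (intro continuous_intros; simp)+
  have e_lim: "(\<lambda>n. e n x) \<longlonglongrightarrow> exp x" for x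
    using exp_converges[of x] unfolding sums_def e_def by (simp add: scaleR_conv_of_real field_simps)
  have e_le: "norm (e n (s * w)) \<le> exp (norm s)" if "norm w \<le> 1" for n s w
  proof -
    have "norm (e n (s * w)) \<le> (\<Sum>k<n. norm s ^ k / fact k)"
      unfolding e_def
    proof (rule sum_norm_le)
      fix k
      have "norm (s * w) ^ k \<le> norm s ^ k"
        using mult_left_mono[OF that norm_ge_zero[of s]] by (intro power_mono) (auto simp: norm_mult)
      then show "norm ((s * w) ^ k / fact k) \<le> norm s ^ k / fact k"
        by (simp add: norm_divide norm_power divide_right_mono)
    qed
    also have "\<dots> \<le> (\<Sum>k. norm s ^ k / fact k)"
      using summable_exp[of "norm s"] by (intro sum_le_suminf) (auto simp: field_simps)
    also have "\<dots> = exp (norm s)"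
      by (simp add: exp_def scaleR_conv_of_real field_simps)
    finally show ?thesis .
  qed
  have V_lim: "(\<lambda>n. V n s t) \<longlonglongrightarrow> exp_transform v s t" for s t
    unfolding V_def exp_transform_def exp_add
  proof (rule dA_dominated_convergence[OF v, where K = "exp (norm s) * exp (norm t)"])
    show "norm (e n (s * w) * e n (t * cnj w)) \<le> exp (norm s) * exp (norm t)" if "norm w < 1" for n w
      unfolding norm_mult using that by (intro mult_mono e_le) auto
    show "(\<lambda>w. e n (s * w) * e n (t * cnj w)) \<in> borel_measurable dA" for n
      by (intro measurable_dA_continuous continuous_intros e_cont)
  qed (auto intro!: measurable_dA_continuous continuous_intros tendsto_intros e_lim AE_I2)
  have V_sing: "det (kernel_mat (V n) s t ?R) = 0" for n s t
  proof -
    let ?p = "\<lambda>i w. e n (s i * w)"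
    have p_meas: "?p i \<in> borel_measurable dA" for i by (rule measurable_dA_continuous[OF e_cont(1)])
    have p_le: "norm (?p i w) \<le> exp (norm (s i))" if "norm w < 1" for i w using that by (intro e_le) simp
    have "toeplitz v (?p i) \<in> fun_space.span B" for i
    proof -
      have "toeplitz v (?p i) = (\<Sum>k<n. fun_scale (s i ^ k / fact k) (toeplitz v (\<lambda>w. w ^ k)))"
      proof
        fix z
        have "toeplitz v (?p i) z = toeplitz v (\<lambda>w. \<Sum>k<n. (s i ^ k / fact k) * w ^ k) z"
          by (simp add: e_def power_mult_distrib)
        also have "\<dots> = (\<Sum>k<n. (s i ^ k / fact k) * toeplitz v (\<lambda>w. w ^ k) z)"
          by (rule toeplitz_sum[OF v, where K = "\<lambda>_. 1"]) (auto simp: norm_power_le_1)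
        also have "\<dots> = (\<Sum>k<n. fun_scale (s i ^ k / fact k) (toeplitz v (\<lambda>w. w ^ k))) z"
          by (simp add: sum_fun_apply fun_scale_def)
        finally show "toeplitz v (?p i) z = \<dots>" .
      qed
      then show ?thesis
        using range by (simp add: fun_space.span_sum fun_space.span_scale)
    qed
    then obtain c i where c: "i < ?R" "c i \<noteq> 0" "\<And>z. (\<Sum>i<?R. c i * toeplitz v (?p i) z) = 0"
      using linear_dependence_in_span[OF B, of ?R "\<lambda>i. toeplitz v (?p i)"] by blast
    let ?q = "\<lambda>w. \<Sum>i<?R. c i * ?p i w"
    have q_meas: "?q \<in> borel_measurable dA"
      using p_meas by (intro borel_measurable_sum borel_measurable_times) auto
    have q_le: "norm (?q w) \<le> (\<Sum>i<?R. norm (c i) * exp (norm (s i)))" if "norm w < 1" for w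
      by (rule sum_norm_le) (simp add: norm_mult mult_left_mono p_le that)
    have "toeplitz v ?q z = (\<Sum>i<?R. c i * toeplitz v (?p i) z)" for z
      by (rule toeplitz_sum[OF v p_meas p_le])
    then have "toeplitz v ?q z = 0" for z
      by (simp only: c(3))
    then have mom: "(\<integral>w. v w * (?q w * cnj w ^ j) \<partial>dA) = 0" for j
      by (intro toeplitz_eq_0_imp_moments_0[OF v q_meas q_le])
    have mom_int: "integrable dA (\<lambda>w. v w * (?q w * cnj w ^ j))" for j
    proof (rule integrable_dA_mult_bounded(1)[OF v])
      have "(\<lambda>w. cnj w ^ j) \<in> borel_measurable dA" by (intro measurable_dA_continuous continuous_intros)
      with q_meas show "(\<lambda>w. ?q w * cnj w ^ j) \<in> borel_measurable dA" by (rule borel_measurable_times)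
      show "norm (?q w * cnj w ^ j) \<le> (\<Sum>i<?R. norm (c i) * exp (norm (s i))) * 1" if "norm w < 1" for w
        unfolding norm_mult[of "?q w"] using that
        by (intro mult_mono q_le) (auto simp: norm_power power_le_one simp del: sum.lessThan_Suc intro!: sum_nonneg)
    qed
    have "(\<Sum>i<?R. V n (s i) b * c i) = 0" for b
    proof -
      have expand: "x * y * e n (b * u) = (\<Sum>k<n. (x * (y * u ^ k)) * (b ^ k / fact k))" for x y u
        unfolding e_def sum_distrib_left by (intro sum.cong refl) (simp add: power_mult_distrib)
      have "(\<Sum>i<?R. V n (s i) b * c i) = (\<Sum>i<?R. \<integral>w. v w * (?p i w * e n (b * cnj w)) * c i \<partial>dA)"
        by (simp add: V_def)
      also have "\<dots> = (\<integral>w. (\<Sum>i<?R. v w * (?p i w * e n (b * cnj w)) * c i) \<partial>dA)"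
      proof (rule Bochner_Integration.integral_sum[symmetric], rule integrable_mult_left)
        show "integrable dA (\<lambda>w. v w * (?p i w * e n (b * cnj w)))" for i
        proof (rule integrable_dA_mult_bounded(1)[OF v])
          show "(\<lambda>w. ?p i w * e n (b * cnj w)) \<in> borel_measurable dA"
            by (intro measurable_dA_continuous continuous_intros e_cont)
          show "norm (?p i w * e n (b * cnj w)) \<le> exp (norm (s i)) * exp (norm b)" if "norm w < 1" for w
            unfolding norm_mult using that by (intro mult_mono e_le) auto
        qed
      qed
      also have "\<dots> = (\<integral>w. (\<Sum>k<n. (v w * (?q w * cnj w ^ k)) * (b ^ k / fact k)) \<partial>dA)"
      proof (rule Bochner_Integration.integral_cong[OF refl])
        fix w
        have "(\<Sum>i<?R. v w * (?p i w * e n (b * cnj w)) * c i) = v w * ?q w * e n (b * cnj w)"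
          by (simp add: sum_distrib_left sum_distrib_right mult_ac del: sum.lessThan_Suc)
        also have "\<dots> = (\<Sum>k<n. (v w * (?q w * cnj w ^ k)) * (b ^ k / fact k))"
          by (rule expand)
        finally show "(\<Sum>i<?R. v w * (?p i w * e n (b * cnj w)) * c i) = \<dots>" .
      qed
      also have "\<dots> = (\<Sum>k<n. \<integral>w. (v w * (?q w * cnj w ^ k)) * (b ^ k / fact k) \<partial>dA)"
        by (rule Bochner_Integration.integral_sum) (rule integrable_mult_left, rule mom_int)
      also have "\<dots> = 0"
        unfolding integral_mult_left_zero mom by simp
      finally show ?thesis .
    qed
    then show ?thesis
      unfolding det_kernel_mat_flip[of "V n"] det_kernel_mat_eq_0_iff using c(1,2) by blast
  qed
  have "det (kernel_mat (exp_transform v) s t ?R) = 0" for s t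
  proof -
    have "(\<lambda>n. det (kernel_mat (V n) s t ?R)) \<longlonglongrightarrow> det (kernel_mat (exp_transform v) s t ?R)"
      by (rule tendsto_det_kernel_mat) (rule V_lim)
    then show ?thesis by (simp add: V_sing LIMSEQ_const_iff)
  qed
  then have zero: "exp_transform v a b = 0" for a b
    by (rule exp_transform_finite_rank_eq_0[OF v])
  have "fourier_null v"
    unfolding fourier_null_def
    using v exp_transform_antidiagonal[of v _ 0 0] zero by auto
  then show ?thesis by (rule fourier_null_AE_0)
qed


section \<open>Quasihomogeneous symbols\<close>

lemma qhom_eq_sgn_power_int: "z \<noteq> 0 \<Longrightarrow> qhom m \<phi> z = \<phi> (norm z) * sgn z powi m"
  by (simp add: qhom_def cis_power_int[symmetric] cis_Arg)

lemma measurable_angular: "(\<lambda>z. cis (of_int m * Arg z)) \<in> borel_measurable dA"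
proof (rule borel_measurable_AE_dA)
  have "(\<lambda>z::complex. z / of_real (norm z)) \<in> borel_measurable dA"
    by (rule borel_measurable_imp_dA) measurable
  then have [measurable]: "(sgn :: complex \<Rightarrow> complex) \<in> borel_measurable dA"
    by (simp add: sgn_eq[abs_def])
  show "(\<lambda>z :: complex. sgn z powi m) \<in> borel_measurable dA"
    unfolding power_int_def by (cases "m \<ge> 0") (simp_all, measurable)
  show "AE z in dA. sgn z powi m = cis (of_int m * Arg z)"
    using AE_dA_nz by eventually_elim (simp add: cis_power_int[symmetric] cis_Arg)
qed

lemma integrable_qhomI:
  assumes "integrable dA (\<lambda>z. \<phi> (norm z))"
  shows "integrable dA (qhom m \<phi>)"
  unfolding qhom_def[abs_def]
  by (rule integrable_dA_mult_bounded(1)[OF assms measurable_angular, where K = 1]) simp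

lemma qhom_shift:
  assumes "w \<noteq> 0"
  shows "qhom (l + int M) (\<lambda>r. \<omega> r * of_real r ^ M) w = qhom l \<omega> w * w ^ M"
proof -
  have "w ^ M = of_real (norm w) ^ M * sgn w ^ M"
    unfolding power_mult_distrib[symmetric] using assms by (simp add: sgn_eq)
  then show ?thesis
    using assms by (simp add: qhom_eq_sgn_power_int power_int_add sgn_zero_iff)
qed

lemma qhom_rotate:
  assumes "norm c = 1" "z \<noteq> 0"
  shows "qhom m \<phi> (c * z) = c powi m * qhom m \<phi> z"
proof -
  have "c * z \<noteq> 0" using assms by auto
  moreover have "sgn c = c" using assms by (simp add: sgn_eq)
  ultimately show ?thesis
    using assms by (simp add: qhom_eq_sgn_power_int norm_mult sgn_mult power_int_mult_distrib)
qed

lemma integrable_cong_AE_dA: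
  fixes f g :: "complex \<Rightarrow> complex"
  assumes "integrable dA f" "AE z in dA. f z = g z"
  shows "integrable dA g"
  using assms borel_measurable_AE_dA[OF _ assms(2)] by (subst integrable_cong_AE[of g dA f]) auto

lemma ex_unimodular_power_int_neq_1:
  fixes D :: "int set"
  assumes "finite D" "0 \<notin> D"
  obtains c :: complex where "norm c = 1" "\<And>d. d \<in> D \<Longrightarrow> c powi d \<noteq> 1"
proof
  \<comment> \<open>\<open>cis x\<close> with \<open>x\<close> so small that no \<open>d x\<close> leaves \<open>(- 1, 1)\<close>, hence none but \<open>0\<close> is a multiple of \<open>2 \<pi>\<close>\<close>
  define S where "S = 1 + (\<Sum>d\<in>D. \<bar>real_of_int d\<bar>)"
  have S: "S \<ge> 1" unfolding S_def by (simp add: sum_nonneg)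
  show "norm (cis (1 / S)) = 1" by simp
  fix d assume d: "d \<in> D"
  then have "\<bar>real_of_int d\<bar> \<le> (\<Sum>d\<in>D. \<bar>real_of_int d\<bar>)" using assms(1) by (intro member_le_sum) auto
  then have "\<bar>real_of_int d\<bar> < S" by (simp add: S_def)
  moreover have "d \<noteq> 0" using d assms by auto
  ultimately have "cis (2 * (of_int d / (2 * S))) \<noteq> 1"
    using S by (intro cis_double_neq_1) (auto simp: abs_mult divide_simps)
  moreover have "2 * (of_int d / (2 * S)) = of_int d * (1 / S)" by simp
  ultimately show "cis (1 / S) powi d \<noteq> 1" by (simp only: cis_power_int not_False_eq_True)
qed

text \<open>
  Integrability of a finite sum passes to its homogeneous components: \<open>f(c z) - c^m\<^sub>0 f(z)\<close> is again
  integrable, has lost the component of degree \<open>m\<^sub>0\<close>, and keeps nonzero multiples of the others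
  if the unimodular number \<open>c\<close> is well chosen. This is needed because a convolution may be
  defined through a decomposition into components that are only assumed to be nearly integrable.
\<close>

lemma integrable_homogeneous_components:
  fixes q :: "int \<Rightarrow> complex \<Rightarrow> complex"
  assumes "finite E" "integrable dA f" "AE z in dA. f z = (\<Sum>m\<in>E. q m z)"
    and "\<And>m c. m \<in> E \<Longrightarrow> norm c = 1 \<Longrightarrow> AE z in dA. q m (c * z) = c powi m * q m z"
    and "m \<in> E"
  shows "integrable dA (q m)"
  using assms
proof (induction E arbitrary: f q m rule: finite_induct)
  case (insert m0 E)
  have "finite ((\<lambda>m. m - m0) ` E)" "0 \<notin> (\<lambda>m. m - m0) ` E" using insert.hyps by auto
  then obtain c :: complex where c: "norm c = 1" "\<And>d. d \<in> (\<lambda>m. m - m0) ` E \<Longrightarrow> c powi d \<noteq> 1"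
    by (rule ex_unimodular_power_int_neq_1) (rule that)
  have c0: "c \<noteq> 0" using c(1) by auto
  have neq: "c powi m - c powi m0 \<noteq> 0" if "m \<in> E" for m
  proof -
    have "c powi m = c powi (m - m0) * c powi m0" using c0 by (subst power_int_add[symmetric]) auto
    then show ?thesis using c(2)[of "m - m0"] that c0 by auto
  qed
  have E: "integrable dA (q m)" if m: "m \<in> E" for m
  proof -
    have "integrable dA (\<lambda>z. (c powi m - c powi m0) * q m z)"
    proof (rule insert.IH[where f = "\<lambda>z. f (c * z) - c powi m0 * f z" and q = "\<lambda>m z. (c powi m - c powi m0) * q m z"])
      show "integrable dA (\<lambda>z. f (c * z) - c powi m0 * f z)"
        using integrable_dA_rotate[OF c(1) insert.prems(1)] insert.prems(1) by simp
      have "AE z in dA. \<forall>m\<in>insert m0 E. q m (c * z) = c powi m * q m z"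
        using insert.prems(3)[OF _ c(1)] insert.hyps by (intro AE_finite_allI) auto
      with insert.prems(2) AE_dA_rotate[OF c(1) insert.prems(2)]
      show "AE z in dA. f (c * z) - c powi m0 * f z = (\<Sum>m\<in>E. (c powi m - c powi m0) * q m z)"
      proof eventually_elim
        case (elim z)
        have "(\<Sum>m\<in>E. q m (c * z)) = (\<Sum>m\<in>E. c powi m * q m z)" using elim by (intro sum.cong) auto
        then show ?case
          using elim insert.hyps by (simp add: algebra_simps sum_subtractf sum_distrib_left)
      qed
      show "AE z in dA. (c powi m - c powi m0) * q m (b * z) = b powi m * ((c powi m - c powi m0) * q m z)"
        if "m \<in> E" "norm b = 1" for m b
        using insert.prems(3)[of m b] that by auto
    qed (use m in auto)
    then have "integrable dA (\<lambda>z. (1 / (c powi m - c powi m0)) * ((c powi m - c powi m0) * q m z))"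
      by (rule integrable_mult_right)
    then show ?thesis using neq[OF m] by simp
  qed
  show ?case
  proof (cases "m \<in> E")
    case False
    then have m: "m = m0" using insert.prems by auto
    have "integrable dA (\<lambda>z. f z - (\<Sum>m\<in>E. q m z))"
      using insert.prems(1) E by (intro Bochner_Integration.integrable_diff Bochner_Integration.integrable_sum) auto
    moreover have "AE z in dA. f z - (\<Sum>m\<in>E. q m z) = q m z"
      using insert.prems(2) by eventually_elim (use insert.hyps m in auto)
    ultimately show ?thesis by (rule integrable_cong_AE_dA)
  qed (rule E)
qed simp

text \<open>
  A rotation by a suitable \<open>c\<close> multiplies the integrand by \<open>c^(m + k - j) \<noteq> 1\<close> without changing the
  integral.
\<close>

lemma qhom_moment_eq_0:
  assumes q: "integrable dA (qhom m \<phi>)" and neq: "int j \<noteq> m + int k"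
  shows "(\<integral>w. qhom m \<phi> w * (w ^ k * cnj w ^ j) \<partial>dA) = 0"
proof -
  let ?F = "\<lambda>w. qhom m \<phi> w * (w ^ k * cnj w ^ j)"
  define d where "d = m + int k - int j"
  obtain c :: complex where c: "norm c = 1" "c powi d \<noteq> 1"
    using ex_unimodular_power_int_neq_1[of "{d}"] neq by (auto simp: d_def)
  have c0: "c \<noteq> 0" using c(1) by auto
  have meas: "?F \<in> borel_measurable dA"
    using borel_measurable_integrable[OF q]
    by (intro borel_measurable_times) (auto intro!: measurable_dA_continuous continuous_intros)
  have cc: "cnj c = inverse c"
    using c(1) by (intro inverse_unique[symmetric]) (simp add: complex_norm_square[symmetric])
  have cd: "c powi m * (c ^ k * cnj c ^ j) = c powi d"
    unfolding cc d_def using c0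
    by (simp add: power_int_add power_int_diff divide_inverse power_inverse)
  have "(\<integral>w. ?F w \<partial>dA) = (\<integral>w. ?F (c * w) \<partial>dA)"
    by (rule integral_dA_rotate[OF c(1) meas, symmetric])
  also have "\<dots> = (\<integral>w. c powi d * ?F w \<partial>dA)"
  proof (rule integral_cong_AE)
    show "(\<lambda>w. ?F (c * w)) \<in> borel_measurable dA"
      using measurable_compose[OF measurable_dA_mult_unimodular[OF c(1)] meas] by simp
    show "AE w in dA. ?F (c * w) = c powi d * ?F w"
      using AE_dA_nz
    proof eventually_elim
      case (elim w)
      have "?F (c * w) = (c powi m * (c ^ k * cnj c ^ j)) * ?F w"
        by (simp add: qhom_rotate[OF c(1) elim] power_mult_distrib mult_ac)
      then show ?case by (simp only: cd)
    qed
  qed (use meas in simp)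
  also have "\<dots> = c powi d * (\<integral>w. ?F w \<partial>dA)" by (rule integral_mult_right_zero)
  finally have "(1 - c powi d) * (\<integral>w. ?F w \<partial>dA) = 0" by (simp add: left_diff_distrib)
  then show ?thesis using c(2) by (simp add: eq_commute[of 1])
qed

text \<open>
  Stated with a moment instead of the Mellin transform, because \<open>\<phi>\<close> itself is known to be measurable
  only where a Mellin transform of it exists.
\<close>

definition toeplitz_coeff :: "int \<Rightarrow> (real \<Rightarrow> complex) \<Rightarrow> nat \<Rightarrow> complex" where
  "toeplitz_coeff m \<phi> k = (if m + int k \<ge> 0
     then of_int (m + int k + 1) * (\<integral>w. qhom m \<phi> w * (w ^ k * cnj w ^ nat (m + int k)) \<partial>dA) else 0)"

lemma toeplitz_qhom_monomial:
  assumes q: "integrable dA (qhom m \<phi>)" and z: "norm z < 1"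
  shows "toeplitz (qhom m \<phi>) (\<lambda>w. w ^ k) z = toeplitz_coeff m \<phi> k * z ^ nat (m + int k)"
proof -
  let ?a = "\<lambda>j. of_nat (Suc j) * (\<integral>w. qhom m \<phi> w * (w ^ k * cnj w ^ j) \<partial>dA)"
  have a: "?a j * z ^ j = (if j = nat (m + int k) then toeplitz_coeff m \<phi> k * z ^ j else 0)" for j
  proof (cases "int j = m + int k")
    case True
    then have "j = nat (m + int k)" "m + int k \<ge> 0" by auto
    moreover have "complex_of_nat (Suc j) = of_int (m + int k + 1)"
      using True by (metis of_int_of_nat_eq of_nat_Suc add.commute)
    ultimately show ?thesis by (simp only: toeplitz_coeff_def if_True simp_thms)
  next
    case False
    then have "?a j = 0" using qhom_moment_eq_0[OF q False] by simp
    moreover have "j = nat (m + int k) \<Longrightarrow> toeplitz_coeff m \<phi> k = 0"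
      using False by (auto simp: toeplitz_coeff_def)
    ultimately show ?thesis
      by (cases "j = nat (m + int k)") (simp_all only: if_True if_False mult_zero_left simp_thms)
  qed
  have "(\<lambda>j. ?a j * z ^ j) sums toeplitz (qhom m \<phi>) (\<lambda>w. w ^ k) z"
    by (rule toeplitz_series[OF q _ norm_power_le_1 z]) auto
  moreover have "(\<lambda>j. ?a j * z ^ j) sums (toeplitz_coeff m \<phi> k * z ^ nat (m + int k))"
    unfolding a by (rule sums_single)
  ultimately show ?thesis by (rule sums_unique2)
qed

lemma qhom_moment_integrand:
  assumes "w \<noteq> 0" "m + int k \<ge> 0"
  shows "qhom m \<phi> w * (w ^ k * cnj w ^ nat (m + int k)) = \<phi> (norm w) * of_real (norm w) ^ (k + nat (m + int k))"
proof -
  define s where "s = sgn w"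
  have w: "w = of_real (norm w) * s" by (simp add: s_def sgn_eq assms)
  have s0: "s \<noteq> 0" using assms by (simp add: s_def sgn_zero_iff)
  have "s * cnj s = 1"
    using assms by (simp add: s_def complex_norm_square[symmetric] norm_sgn)
  then have cs: "cnj s = inverse s" by (rule inverse_unique[symmetric])
  have pw: "s powi m * (s ^ k * inverse s ^ nat (m + int k)) = 1"
  proof -
    have "s powi m * s ^ k = s powi (m + int k)" using s0 by (simp add: power_int_add)
    also have "\<dots> = s ^ nat (m + int k)" using assms(2) by (simp add: power_int_def)
    finally have "s powi m * s ^ k * inverse s ^ nat (m + int k) = (s * inverse s) ^ nat (m + int k)"
      by (simp only: power_mult_distrib)
    then show ?thesis using s0 by (simp add: mult.assoc)
  qed
  have "qhom m \<phi> w * (w ^ k * cnj w ^ nat (m + int k)) =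
     \<phi> (norm w) * of_real (norm w) ^ (k + nat (m + int k)) * (s powi m * (s ^ k * cnj s ^ nat (m + int k)))"
    unfolding qhom_eq_sgn_power_int[OF assms(1)] s_def[symmetric]
    by (subst (2 3) w) (simp add: power_mult_distrib power_add mult_ac)
  then show ?thesis by (simp only: cs pw mult_1_right)
qed

lemma toeplitz_coeff_mellin:
  assumes q: "integrable dA (qhom m \<phi>)" and \<phi>: "\<phi> \<in> borel_measurable unit_interval_measure"
    and nonneg: "m + int k \<ge> 0"
  shows "toeplitz_coeff m \<phi> k = of_int (m + int k + 1) * (2 * mellin \<phi> (of_int (2 * int k + m + 2)))"
proof -
  let ?N = "k + nat (m + int k)"
  let ?g = "\<lambda>r. \<phi> r * of_real r ^ ?N"
  have idm [measurable]: "(of_real :: real \<Rightarrow> complex) \<in> borel_measurable unit_interval_measure"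
    by (auto intro!: measurable_restrict_space1 measurable_completion)
  have g: "?g \<in> borel_measurable unit_interval_measure"
    using \<phi> by measurable
  have "(\<integral>w. qhom m \<phi> w * (w ^ k * cnj w ^ nat (m + int k)) \<partial>dA) = (\<integral>w. ?g (norm w) \<partial>dA)"
  proof (rule integral_cong_AE)
    show "(\<lambda>w. qhom m \<phi> w * (w ^ k * cnj w ^ nat (m + int k))) \<in> borel_measurable dA"
      using borel_measurable_integrable[OF q]
      by (intro borel_measurable_times) (auto intro!: measurable_dA_continuous continuous_intros)
    show "(\<lambda>w. ?g (norm w)) \<in> borel_measurable dA" by (rule measurable_dA_norm[OF g])
    show "AE w in dA. qhom m \<phi> w * (w ^ k * cnj w ^ nat (m + int k)) = ?g (norm w)"
      using AE_dA_nz by eventually_elim (rule qhom_moment_integrand[OF _ nonneg])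
  qed
  also have "\<dots> = 2 * (\<integral>r. ?g r * of_real r \<partial>unit_interval_measure)"
    by (rule integral_dA_norm[OF g])
  also have "(\<integral>r. ?g r * of_real r \<partial>unit_interval_measure) = mellin \<phi> (of_int (2 * int k + m + 2))"
    unfolding mellin_def
  proof (rule Bochner_Integration.integral_cong[OF refl])
    fix r assume "r \<in> space unit_interval_measure"
    then have r: "complex_of_real r \<noteq> 0" by simp
    have "complex_of_int (2 * int k + m + 2) - 1 = of_nat (Suc ?N)"
    proof -
      have "int (Suc ?N) = 2 * int k + m + 2 - 1" using nonneg by simp
      then show ?thesis by (metis of_int_1 of_int_diff of_int_of_nat_eq)
    qed
    then have "complex_of_real r powr (complex_of_int (2 * int k + m + 2) - 1) = of_real r ^ Suc ?N"
      using r by (simp only: powr_nat' simp_thms)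
    then show "?g r * of_real r = \<phi> r * of_real r powr (complex_of_int (2 * int k + m + 2) - 1)"
      by (simp add: mult_ac)
  qed
  finally show ?thesis using nonneg by (simp add: toeplitz_coeff_def)
qed

lemma SQH_integrable: "f \<in> SQH \<Longrightarrow> integrable dA f"
proof -
  assume "f \<in> SQH"
  then obtain E \<phi> where E: "finite E" "\<forall>m\<in>E. integrable dA (qhom m (\<phi> m))"
    "AE z in dA. f z = (\<Sum>m\<in>E. qhom m (\<phi> m) z)"
    by (auto simp: SQH_def)
  show ?thesis
  proof (rule integrable_cong_AE_dA)
    show "integrable dA (\<lambda>z. \<Sum>m\<in>E. qhom m (\<phi> m) z)" using E(2) by (intro Bochner_Integration.integrable_sum) auto
    show "AE z in dA. (\<Sum>m\<in>E. qhom m (\<phi> m) z) = f z" using E(3) by eventually_elim simp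
  qed
qed

lemma toeplitz_qhom_sum_monomial:
  assumes f: "integrable dA f" "AE z in dA. f z = (\<Sum>m\<in>E. qhom m (\<phi> m) z)"
    and q: "\<And>m. m \<in> E \<Longrightarrow> integrable dA (qhom m (\<phi> m))" and z: "norm z < 1"
  shows "toeplitz f (\<lambda>w. w ^ k) z = (\<Sum>m\<in>E. toeplitz_coeff m (\<phi> m) k * z ^ nat (m + int k))"
proof -
  have "toeplitz f (\<lambda>w. w ^ k) z = toeplitz (\<lambda>z. \<Sum>m\<in>E. qhom m (\<phi> m) z) (\<lambda>w. w ^ k) z"
    by (rule fun_cong[OF toeplitz_cong_AE[OF f]]) simp
  also have "\<dots> = (\<Sum>m\<in>E. toeplitz (qhom m (\<phi> m)) (\<lambda>w. w ^ k) z)"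
    by (rule toeplitz_symbol_sum[OF q _ norm_power_le_1]) auto
  finally show ?thesis using toeplitz_qhom_monomial[OF q z] by simp
qed

lemma SQH_toeplitz_monomial:
  assumes "g \<in> SQH"
  obtains p where "\<And>z. norm z < 1 \<Longrightarrow> toeplitz g (\<lambda>w. w ^ k) z = poly p z"
proof -
  obtain E \<phi> where E: "finite E" "\<forall>m\<in>E. integrable dA (qhom m (\<phi> m))"
    "AE z in dA. g z = (\<Sum>m\<in>E. qhom m (\<phi> m) z)"
    using assms by (auto simp: SQH_def)
  have "toeplitz g (\<lambda>w. w ^ k) z = poly (\<Sum>m\<in>E. monom (toeplitz_coeff m (\<phi> m) k) (nat (m + int k))) z"
    if "norm z < 1" for z
    using toeplitz_qhom_sum_monomial[OF SQH_integrable[OF assms] E(3) _ that, of k] E(2)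
    by (simp add: poly_sum poly_monom)
  then show ?thesis by (rule that)
qed

lemma SQH_toeplitz_monomial_bounded:
  assumes "g \<in> SQH"
  shows "toeplitz g (\<lambda>w. w ^ k) \<in> borel_measurable dA"
    and "\<exists>K. \<forall>z. norm z < 1 \<longrightarrow> norm (toeplitz g (\<lambda>w. w ^ k) z) \<le> K"
proof -
  obtain p where p: "\<And>z. norm z < 1 \<Longrightarrow> toeplitz g (\<lambda>w. w ^ k) z = poly p z"
    using SQH_toeplitz_monomial[OF assms] by blast
  have "poly p \<in> borel_measurable dA"
    by (intro measurable_dA_continuous continuous_intros)
  then show "toeplitz g (\<lambda>w. w ^ k) \<in> borel_measurable dA"
    by (rule measurable_cong[THEN iffD1, rotated]) (simp add: p)
  have "bounded (poly p ` cball 0 1)"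
    by (intro compact_imp_bounded compact_continuous_image continuous_intros) auto
  then obtain K where "\<forall>x\<in>poly p ` cball 0 1. norm x \<le> K"
    unfolding bounded_iff by blast
  then show "\<exists>K. \<forall>z. norm z < 1 \<longrightarrow> norm (toeplitz g (\<lambda>w. w ^ k) z) \<le> K"
    using p by (intro exI[of _ K]) auto
qed

lemma toeplitz_product_sum:
  assumes f: "integrable dA f" and g: "g \<in> SQH"
  shows "toeplitz f (toeplitz g (\<lambda>w. \<Sum>i\<in>I. c i * w ^ e i)) z =
    (\<Sum>i\<in>I. c i * toeplitz f (toeplitz g (\<lambda>w. w ^ e i)) z)"
proof -
  obtain K where K: "\<And>k z. norm z < 1 \<Longrightarrow> norm (toeplitz g (\<lambda>w. w ^ k) z) \<le> K k"
    using SQH_toeplitz_monomial_bounded(2)[OF g] by metis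
  have "toeplitz g (\<lambda>w. \<Sum>i\<in>I. c i * w ^ e i) = (\<lambda>z. \<Sum>i\<in>I. c i * toeplitz g (\<lambda>w. w ^ e i) z)"
    by (rule ext, rule toeplitz_sum[OF SQH_integrable[OF g], where K = "\<lambda>_. 1"]) (auto simp: norm_power_le_1)
  then show ?thesis
    using toeplitz_sum[OF f SQH_toeplitz_monomial_bounded(1)[OF g] K, where I = I] by simp
qed


section \<open>Products of Toeplitz operators and the convolution\<close>

lemma measurable_radial_factor:
  fixes \<phi> :: "real \<Rightarrow> complex"
  assumes "(\<lambda>r. \<phi> r * u r) \<in> borel_measurable unit_interval_measure"
    and "u \<in> borel_measurable unit_interval_measure" "\<And>r. 0 < r \<Longrightarrow> r < 1 \<Longrightarrow> u r \<noteq> 0"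
  shows "\<phi> \<in> borel_measurable unit_interval_measure"
proof -
  have "(\<lambda>r. \<phi> r * u r / u r) \<in> borel_measurable unit_interval_measure"
    using assms(1,2) by (rule borel_measurable_divide)
  then show ?thesis
    by (rule measurable_cong[THEN iffD1, rotated]) (use assms(3) in simp)
qed

lemma measurable_unit_continuous:
  fixes u :: "real \<Rightarrow> complex"
  assumes "continuous_on {0<..<1} u"
  shows "u \<in> borel_measurable unit_interval_measure"
  by (rule continuous_imp_measurable_on_sets_lebesgue[OF assms]) auto

lemma mellin_exists_imp_measurable:
  assumes "mellin_exists \<phi> \<zeta>"
  shows "\<phi> \<in> borel_measurable unit_interval_measure"
proof (rule measurable_radial_factor)
  show "(\<lambda>r. \<phi> r * of_real r powr (\<zeta> - 1)) \<in> borel_measurable unit_interval_measure"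
    using assms unfolding mellin_exists_def by (rule borel_measurable_integrable)
  show "(\<lambda>r. complex_of_real r powr (\<zeta> - 1)) \<in> borel_measurable unit_interval_measure"
    by (intro measurable_unit_continuous continuous_intros) (auto simp: complex_nonpos_Reals_iff)
qed simp

lemma nearly_integrable_imp_eventually_integrable:
  assumes "nearly_integrable \<omega>"
  shows "eventually (\<lambda>M. integrable dA (\<lambda>w. qhom l \<omega> w * w ^ M)) sequentially"
    and "\<omega> \<in> borel_measurable unit_interval_measure"
proof -
  obtain \<alpha> where a: "\<alpha> > 0" "integrable unit_interval_measure (\<lambda>r. of_real (r powr \<alpha>) * \<omega> r)"
    using assms by (auto simp: nearly_integrable_def)
  have pm: "(\<lambda>r. complex_of_real (r powr \<alpha>)) \<in> borel_measurable unit_interval_measure"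
    by (intro measurable_unit_continuous continuous_intros) auto
  show om: "\<omega> \<in> borel_measurable unit_interval_measure"
  proof (rule measurable_radial_factor[OF _ pm])
    show "(\<lambda>r. \<omega> r * of_real (r powr \<alpha>)) \<in> borel_measurable unit_interval_measure"
      using borel_measurable_integrable[OF a(2)] by (simp only: mult.commute)
  qed simp
  have rm: "(\<lambda>r. complex_of_real r ^ N) \<in> borel_measurable unit_interval_measure" for N
    by (intro measurable_unit_continuous continuous_intros)
  have "integrable dA (\<lambda>w. qhom l \<omega> w * w ^ M)" if M: "M \<ge> nat \<lceil>\<alpha>\<rceil>" for M
  proof -
    let ?g = "\<lambda>r. \<omega> r * of_real r ^ M"
    have "integrable unit_interval_measure (\<lambda>r. ?g r * of_real r)"
    proof (rule Bochner_Integration.integrable_bound[OF a(2)])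
      show "(\<lambda>r. ?g r * of_real r) \<in> borel_measurable unit_interval_measure"
        by (intro borel_measurable_times om rm rm[of 1, unfolded power_one_right])
      show "AE r in unit_interval_measure. norm (?g r * of_real r) \<le> norm (of_real (r powr \<alpha>) * \<omega> r)"
      proof (rule AE_I2)
        fix r :: real assume "r \<in> space unit_interval_measure"
        then have r: "0 < r" "r < 1" by auto
        have "r ^ M * r = r powr real (Suc M)" using r by (simp only: powr_realpow power_Suc2)
        also have "\<dots> \<le> r powr \<alpha>"
          using r M by (intro powr_mono') linarith+
        finally have "norm (\<omega> r) * (r ^ M * r) \<le> norm (\<omega> r) * r powr \<alpha>"
          by (intro mult_left_mono) auto
        then show "norm (?g r * of_real r) \<le> norm (of_real (r powr \<alpha>) * \<omega> r)"
          using r by (simp add: norm_mult norm_power mult_ac)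
      qed
    qed
    then have "integrable dA (\<lambda>w. ?g (norm w))"
      using om rm[of M] by (subst integrable_dA_norm_iff) (auto intro!: borel_measurable_times)
    then have "integrable dA (qhom (l + int M) ?g)" by (rule integrable_qhomI)
    moreover have "AE w in dA. qhom (l + int M) ?g w = qhom l \<omega> w * w ^ M"
      using AE_dA_nz by eventually_elim (rule qhom_shift)
    ultimately show ?thesis by (rule integrable_cong_AE_dA)
  qed
  then show "eventually (\<lambda>M. integrable dA (\<lambda>w. qhom l \<omega> w * w ^ M)) sequentially"
    unfolding eventually_sequentially by blast
qed

text \<open>
  The symbol \<open>\<omega>(r) e\<^sup>i\<^sup>l\<^sup>\<theta>\<close> need not be integrable; times \<open>w^M\<close> it is quasihomogeneous of degree
  \<open>l + M\<close> with profile \<open>\<omega>(r) r^M\<close>, and the formula for \<open>w^(j + M)\<close> that it would satisfy formally holds.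
\<close>

lemma toeplitz_qhom_shift_monomial:
  assumes om: "\<omega> \<in> borel_measurable unit_interval_measure"
    and i: "integrable dA (\<lambda>w. qhom l \<omega> w * w ^ M)" and z: "norm z < 1"
    and nonneg: "l + int (j + M) \<ge> 0"
  shows "toeplitz (\<lambda>w. qhom l \<omega> w * w ^ M) (\<lambda>w. w ^ j) z =
    of_int (l + int (j + M) + 1) * (2 * mellin \<omega> (of_int (2 * int (j + M) + l + 2))) * z ^ nat (l + int (j + M))"
proof -
  let ?g = "\<lambda>r. \<omega> r * of_real r ^ M"
  have ae: "AE w in dA. qhom l \<omega> w * w ^ M = qhom (l + int M) ?g w"
    using AE_dA_nz by eventually_elim (rule qhom_shift[symmetric])
  have ig: "integrable dA (qhom (l + int M) ?g)"
    by (rule integrable_cong_AE_dA[OF i ae])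
  have gm: "?g \<in> borel_measurable unit_interval_measure"
    by (intro borel_measurable_times om measurable_unit_continuous continuous_intros)
  have "toeplitz (\<lambda>w. qhom l \<omega> w * w ^ M) (\<lambda>w. w ^ j) z = toeplitz (qhom (l + int M) ?g) (\<lambda>w. w ^ j) z"
    by (rule fun_cong[OF toeplitz_cong_AE[OF i ae]]) simp
  also have "\<dots> = toeplitz_coeff (l + int M) ?g j * z ^ nat (l + int M + int j)"
    by (rule toeplitz_qhom_monomial[OF ig z])
  also have "toeplitz_coeff (l + int M) ?g j = of_int (l + int M + int j + 1) * (2 * mellin ?g (of_int (2 * int j + (l + int M) + 2)))"
    by (rule toeplitz_coeff_mellin[OF ig gm]) (use nonneg in simp)
  also have "mellin ?g (of_int (2 * int j + (l + int M) + 2)) = mellin \<omega> (of_int (2 * int (j + M) + l + 2))"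
    unfolding mellin_def
  proof (rule Bochner_Integration.integral_cong[OF refl])
    fix r assume "r \<in> space unit_interval_measure"
    then have r: "complex_of_real r \<noteq> 0" by simp
    have "complex_of_int (2 * int (j + M) + l + 2) - 1 = of_nat M + (of_int (2 * int j + (l + int M) + 2) - 1)"
      by simp
    then show "?g r * of_real r powr (of_int (2 * int j + (l + int M) + 2) - 1) =
        \<omega> r * of_real r powr (complex_of_int (2 * int (j + M) + l + 2) - 1)"
      using r by (simp only: powr_add powr_nat' simp_thms mult.assoc)
  qed
  finally show ?thesis by (simp add: add_ac)
qed

text \<open>
  The defining equation of the convolution at \<open>\<zeta> = 2 K + m + n + 2\<close>. Its factor
  \<open>\<zeta> - m + n = 2 (n + K + 1)\<close> is the normalization that \<open>T\<^sub>g\<close> contributes and that the Toeplitz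
  operator of the convolution lacks.
\<close>

lemma is_diamond_qhom_coeff:
  assumes qm: "integrable dA (qhom m \<phi>)" and qn: "integrable dA (qhom n \<psi>)"
    and \<phi>: "\<phi> \<in> borel_measurable unit_interval_measure" and \<psi>: "\<psi> \<in> borel_measurable unit_interval_measure"
    and K: "n + int K \<ge> 0" "m + n + int K \<ge> 0"
    and mel: "\<And>\<zeta>. \<zeta> = of_int (2 * int K + (m + n) + 2) \<Longrightarrow> mellin \<omega> \<zeta> =
       (\<zeta> - of_int m + of_int n) * mellin \<phi> (\<zeta> + of_int n) * mellin \<psi> (\<zeta> - of_int m)"
  shows "toeplitz_coeff n \<psi> K * toeplitz_coeff m \<phi> (nat (n + int K)) =
    of_int (m + n + int K + 1) * (2 * mellin \<omega> (of_int (2 * int K + (m + n) + 2)))"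
proof -
  have c1: "toeplitz_coeff n \<psi> K = of_int (n + int K + 1) * (2 * mellin \<psi> (of_int (2 * int K + n + 2)))"
    by (rule toeplitz_coeff_mellin[OF qn \<psi> K(1)])
  have c2: "toeplitz_coeff m \<phi> (nat (n + int K)) =
      of_int (m + (n + int K) + 1) * (2 * mellin \<phi> (of_int (2 * (n + int K) + m + 2)))"
    using toeplitz_coeff_mellin[OF qm \<phi>, of "nat (n + int K)"] K by (simp add: add_ac)
  let ?z = "complex_of_int (2 * int K + (m + n) + 2)"
  have z: "?z + of_int n = of_int (2 * (n + int K) + m + 2)" "?z - of_int m = of_int (2 * int K + n + 2)"
    "?z - of_int m + of_int n = 2 * of_int (n + int K + 1)"
    by simp_all
  have "mellin \<omega> ?z = 2 * of_int (n + int K + 1) * mellin \<phi> (of_int (2 * (n + int K) + m + 2)) * mellin \<psi> (of_int (2 * int K + n + 2))"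
    using mel[OF refl] unfolding z(3) unfolding z(1,2) .
  then show ?thesis
    unfolding c1 c2 by (simp only: add.assoc mult_ac)
qed

text \<open>
  Every pair of components imposes a lower bound on \<open>M\<close>: the exponents must be nonnegative, the
  point \<open>\<zeta>\<close> must lie in the half-plane of the defining equation, and the factor \<open>z^M\<close> must absorb the
  singularity of the component at the origin. There are finitely many pairs, so all large \<open>M\<close> are
  admissible, and so they are for finitely many convolutions together.
\<close>

lemma diamond_toeplitz_shift:
  assumes f: "f \<in> SQH" and g: "g \<in> SQH" and d: "is_diamond f g k"
  shows "eventually (\<lambda>M. integrable dA (\<lambda>z. k z * z ^ M) \<and>
     (\<forall>j. toeplitz f (toeplitz g (\<lambda>w. w ^ (j + M))) = toeplitz (\<lambda>z. k z * z ^ M) (\<lambda>w. w ^ j))) sequentially"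
proof -
  obtain E E' \<phi> \<psi> \<omega> where fin: "finite E" "finite E'"
    and fE: "AE z in dA. f z = (\<Sum>m\<in>E. qhom m (\<phi> m) z)"
    and gE: "AE z in dA. g z = (\<Sum>n\<in>E'. qhom n (\<psi> n) z)"
    and dq: "\<And>m n. m \<in> E \<Longrightarrow> n \<in> E' \<Longrightarrow> is_diamond_qhom m (\<phi> m) n (\<psi> n) (\<omega> m n)"
    and kE: "AE z in dA. k z = (\<Sum>m\<in>E. \<Sum>n\<in>E'. qhom (m + n) (\<omega> m n) z)"
    using d unfolding is_diamond_def by blast
  note fi = SQH_integrable[OF f] and gi = SQH_integrable[OF g]
  have rot: "AE z in dA. qhom m \<phi> (c * z) = c powi m * qhom m \<phi> z" if "norm c = 1" for m \<phi> c
    using AE_dA_nz by eventually_elim (rule qhom_rotate[OF that])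
  have qf: "integrable dA (qhom m (\<phi> m))" if "m \<in> E" for m
    by (rule integrable_homogeneous_components[OF fin(1) fi fE _ that]) (rule rot)
  have qg: "integrable dA (qhom n (\<psi> n))" if "n \<in> E'" for n
    by (rule integrable_homogeneous_components[OF fin(2) gi gE _ that]) (rule rot)
  have "\<exists>a::real. \<forall>\<zeta>. Re \<zeta> > a \<longrightarrow> mellin_exists (\<phi> m) (\<zeta> + of_int n) \<and> mellin_exists (\<psi> n) (\<zeta> - of_int m) \<and>
        mellin (\<omega> m n) \<zeta> = (\<zeta> - of_int m + of_int n) * mellin (\<phi> m) (\<zeta> + of_int n) * mellin (\<psi> n) (\<zeta> - of_int m)"
    if "m \<in> E" "n \<in> E'" for m n
    using dq[OF that] unfolding is_diamond_qhom_def by blast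
  then obtain a :: "int \<Rightarrow> int \<Rightarrow> real" where a: "\<And>m n \<zeta>. m \<in> E \<Longrightarrow> n \<in> E' \<Longrightarrow> Re \<zeta> > a m n \<Longrightarrow>
        mellin_exists (\<phi> m) (\<zeta> + of_int n) \<and> mellin_exists (\<psi> n) (\<zeta> - of_int m) \<and>
        mellin (\<omega> m n) \<zeta> = (\<zeta> - of_int m + of_int n) * mellin (\<phi> m) (\<zeta> + of_int n) * mellin (\<psi> n) (\<zeta> - of_int m)"
    by metis
  have meas: "\<phi> m \<in> borel_measurable unit_interval_measure" "\<psi> n \<in> borel_measurable unit_interval_measure"
    if "m \<in> E" "n \<in> E'" for m n
    using a[OF that, of "of_real (a m n + 1)"] by (auto intro: mellin_exists_imp_measurable)
  have \<omega>m: "\<omega> m n \<in> borel_measurable unit_interval_measure"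
    and \<omega>i: "eventually (\<lambda>M. integrable dA (\<lambda>w. qhom (m + n) (\<omega> m n) w * w ^ M)) sequentially"
    if "m \<in> E" "n \<in> E'" for m n
    using dq[OF that] nearly_integrable_imp_eventually_integrable
    unfolding is_diamond_qhom_def by blast+
  define Q where "Q m n M \<longleftrightarrow> n + int M \<ge> 0 \<and> m + n + int M \<ge> 0 \<and> a m n < of_int (2 * int M + (m + n) + 2) \<and>
     integrable dA (\<lambda>w. qhom (m + n) (\<omega> m n) w * w ^ M)" for m n M
  have "eventually (Q m n) sequentially" if "m \<in> E" "n \<in> E'" for m n
  proof -
    let ?M = "nat \<bar>n\<bar> + nat \<bar>m\<bar> + nat \<lceil>\<bar>a m n\<bar>\<rceil>"
    have "n + int M \<ge> 0 \<and> m + n + int M \<ge> 0 \<and> a m n < of_int (2 * int M + (m + n) + 2)" if "M \<ge> ?M" for M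
    proof -
      have 1: "\<bar>n\<bar> + \<bar>m\<bar> + \<lceil>\<bar>a m n\<bar>\<rceil> \<le> int M" using that by linarith
      then have "a m n \<le> of_int (int M - \<bar>n\<bar> - \<bar>m\<bar>)" by linarith
      also have "\<dots> < of_int (2 * int M + (m + n) + 2)" using 1 by (subst of_int_less_iff) linarith
      finally show ?thesis using 1 by linarith
    qed
    then have "eventually (\<lambda>M. n + int M \<ge> 0 \<and> m + n + int M \<ge> 0 \<and> a m n < of_int (2 * int M + (m + n) + 2)) sequentially"
      unfolding eventually_sequentially by blast
    with \<omega>i[OF that] show ?thesis
      by eventually_elim (simp add: Q_def)
  qed
  then have "eventually (\<lambda>M. \<forall>m\<in>E. \<forall>n\<in>E'. Q m n M) sequentially"
    using fin by (intro eventually_ball_finite ballI) auto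
  \<comment> \<open>not implied by the bounds for pairs when \<open>E\<close> is empty\<close>
  moreover have "eventually (\<lambda>M. \<forall>n\<in>E'. n + int M \<ge> 0) sequentially"
  proof (intro eventually_ball_finite[OF fin(2)] ballI)
    fix n :: int
    show "eventually (\<lambda>M. n + int M \<ge> 0) sequentially"
      using eventually_ge_at_top[of "nat \<bar>n\<bar>"] by eventually_elim linarith
  qed
  ultimately show ?thesis
  proof eventually_elim
    case (elim M)
    then have Q: "Q m n M" if "m \<in> E" "n \<in> E'" for m n using that by blast
    let ?P = "E \<times> E'"
    let ?q = "\<lambda>(m, n) z. qhom (m + n) (\<omega> m n) z * z ^ M"
    have kM: "AE z in dA. k z * z ^ M = (\<Sum>p\<in>?P. ?q p z)"
      using kE by eventually_elim (simp add: sum_distrib_right sum.cartesian_product case_prod_beta)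
    have qi: "integrable dA (?q p)" if "p \<in> ?P" for p
      using Q that by (auto simp: Q_def)
    have sum_i: "integrable dA (\<lambda>z. \<Sum>p\<in>?P. ?q p z)"
      by (rule Bochner_Integration.integrable_sum) (rule qi)
    have ki: "integrable dA (\<lambda>z. k z * z ^ M)"
      by (rule integrable_cong_AE_dA[OF sum_i]) (use kM in \<open>auto simp: eq_commute\<close>)
    have "toeplitz f (toeplitz g (\<lambda>w. w ^ (j + M))) z = toeplitz (\<lambda>z. k z * z ^ M) (\<lambda>w. w ^ j) z" for j z
    proof (cases "norm z < 1")
      case z: True
      let ?K = "j + M"
      have fmono: "toeplitz f (\<lambda>w. w ^ i) z = (\<Sum>m\<in>E. toeplitz_coeff m (\<phi> m) i * z ^ nat (m + int i))" for i
        by (rule toeplitz_qhom_sum_monomial[OF fi fE _ z]) (rule qf)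
      have nK: "n + int ?K \<ge> 0" if "n \<in> E'" for n using elim(2) that by force
      have "toeplitz f (toeplitz g (\<lambda>w. w ^ ?K)) z =
          toeplitz f (\<lambda>w. \<Sum>n\<in>E'. toeplitz_coeff n (\<psi> n) ?K * w ^ nat (n + int ?K)) z"
        by (rule fun_cong[OF toeplitz_cong[OF toeplitz_qhom_sum_monomial[OF gi gE qg]]]) auto
      also have "\<dots> = (\<Sum>n\<in>E'. toeplitz_coeff n (\<psi> n) ?K * toeplitz f (\<lambda>w. w ^ nat (n + int ?K)) z)"
        by (rule toeplitz_sum[OF fi, where K = "\<lambda>_. 1"]) (auto simp: norm_power_le_1)
      also have "\<dots> = (\<Sum>n\<in>E'. \<Sum>m\<in>E. toeplitz_coeff n (\<psi> n) ?K * toeplitz_coeff m (\<phi> m) (nat (n + int ?K)) * z ^ nat (m + n + int ?K))"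
      proof (rule sum.cong[OF refl])
        fix n assume n: "n \<in> E'"
        show "toeplitz_coeff n (\<psi> n) ?K * toeplitz f (\<lambda>w. w ^ nat (n + int ?K)) z =
            (\<Sum>m\<in>E. toeplitz_coeff n (\<psi> n) ?K * toeplitz_coeff m (\<phi> m) (nat (n + int ?K)) * z ^ nat (m + n + int ?K))"
          unfolding fmono sum_distrib_left
          by (intro sum.cong refl) (use nK[OF n] in \<open>simp add: mult.assoc add.assoc\<close>)
      qed
      also have "\<dots> = (\<Sum>m\<in>E. \<Sum>n\<in>E'. toeplitz (?q (m, n)) (\<lambda>w. w ^ j) z)"
      proof (subst sum.swap, intro sum.cong refl)
        fix m n assume mn: "m \<in> E" "n \<in> E'"
        note Qmn = Q[OF mn, unfolded Q_def]
        have "toeplitz_coeff n (\<psi> n) ?K * toeplitz_coeff m (\<phi> m) (nat (n + int ?K)) =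
            of_int (m + n + int ?K + 1) * (2 * mellin (\<omega> m n) (of_int (2 * int ?K + (m + n) + 2)))"
        proof (rule is_diamond_qhom_coeff[OF qf[OF mn(1)] qg[OF mn(2)] meas[OF mn]])
          fix \<zeta> :: complex assume \<zeta>: "\<zeta> = of_int (2 * int ?K + (m + n) + 2)"
          have "a m n < Re \<zeta>" using Qmn by (simp add: \<zeta>)
          then show "mellin (\<omega> m n) \<zeta> = (\<zeta> - of_int m + of_int n) * mellin (\<phi> m) (\<zeta> + of_int n) * mellin (\<psi> n) (\<zeta> - of_int m)"
            using a[OF mn] by blast
        qed (use Qmn in auto)
        moreover have "toeplitz (?q (m, n)) (\<lambda>w. w ^ j) z = of_int (m + n + int ?K + 1) *
            (2 * mellin (\<omega> m n) (of_int (2 * int ?K + (m + n) + 2))) * z ^ nat (m + n + int ?K)"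
          unfolding prod.case
          by (rule toeplitz_qhom_shift_monomial[OF \<omega>m[OF mn] _ z]) (use Qmn in auto)
        ultimately show "toeplitz_coeff n (\<psi> n) ?K * toeplitz_coeff m (\<phi> m) (nat (n + int ?K)) * z ^ nat (m + n + int ?K) =
            toeplitz (?q (m, n)) (\<lambda>w. w ^ j) z"
          by (simp only:)
      qed
      also have "\<dots> = (\<Sum>p\<in>?P. toeplitz (?q p) (\<lambda>w. w ^ j) z)"
        by (simp only: sum.cartesian_product case_prod_eta) (simp add: case_prod_beta)
      also have "\<dots> = toeplitz (\<lambda>z. \<Sum>p\<in>?P. ?q p z) (\<lambda>w. w ^ j) z"
        by (rule toeplitz_symbol_sum[OF qi _ norm_power_le_1, symmetric]) auto
      also have "\<dots> = toeplitz (\<lambda>z. k z * z ^ M) (\<lambda>w. w ^ j) z"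
        by (rule fun_cong[OF toeplitz_cong_AE[OF ki kM, symmetric]]) simp
      finally show ?thesis .
    qed (simp add: toeplitz_off_disk)
    then show ?case using ki by blast
  qed
qed


section \<open>Finite rank of sums of products\<close>

theorem theorem2p10:
  shows
    "(\<forall>f g k. f \<in> SQH \<longrightarrow> g \<in> SQH \<longrightarrow> is_diamond f g k \<longrightarrow>
        (\<exists>M::nat. integrable dA (\<lambda>z. k z * z ^ M) \<and>
           finite_rank ((toeplitz f \<circ> toeplitz (\<lambda>z. g z * z ^ M)) - toeplitz (\<lambda>z. k z * z ^ M))))
     \<and>
     (\<forall>(N::nat) F G K H. N \<ge> 1 \<longrightarrow>
        (\<forall>j\<in>{1..N}. F j \<in> SQH \<and> G j \<in> SQH \<and> is_diamond (F j) (G j) (K j)) \<longrightarrow>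
        integrable dA H \<longrightarrow>
        (finite_rank ((\<Sum>j=1..N. toeplitz (F j) \<circ> toeplitz (G j)) - toeplitz H) \<longleftrightarrow>
           integrable dA (\<lambda>z. \<Sum>j=1..N. K j z) \<and> (AE z in dA. H z = (\<Sum>j=1..N. K j z))))"
proof (intro conjI allI impI)
  fix f g k :: "complex \<Rightarrow> complex"
  assume f: "f \<in> SQH" and g: "g \<in> SQH" and d: "is_diamond f g k"
  obtain M where ki: "integrable dA (\<lambda>z. k z * z ^ M)"
    and shift: "\<And>j. toeplitz f (toeplitz g (\<lambda>w. w ^ (j + M))) = toeplitz (\<lambda>z. k z * z ^ M) (\<lambda>w. w ^ j)"
    using diamond_toeplitz_shift[OF f g d] unfolding eventually_sequentially by blast
  have "toeplitz f (toeplitz (\<lambda>z. g z * z ^ M) (poly p)) z = toeplitz (\<lambda>z. k z * z ^ M) (poly p) z" for p z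
  proof -
    have "toeplitz (\<lambda>z. g z * z ^ M) (poly p) = toeplitz g (\<lambda>w. \<Sum>i\<le>degree p. coeff p i * w ^ (i + M))"
    proof -
      have "(\<lambda>w. w ^ M * poly p w) = (\<lambda>w. \<Sum>i\<le>degree p. coeff p i * w ^ (i + M))"
        by (simp add: poly_altdef sum_distrib_left power_add mult_ac)
      moreover have "toeplitz (\<lambda>z. g z * z ^ M) (poly p) = toeplitz g (\<lambda>w. w ^ M * poly p w)"
        by (simp add: toeplitz_def mult.assoc cong: if_cong)
      ultimately show ?thesis by (simp only:)
    qed
    then show ?thesis
      by (simp add: toeplitz_product_sum[OF SQH_integrable[OF f] g] shift toeplitz_poly[OF ki])
  qed
  then have "((toeplitz f \<circ> toeplitz (\<lambda>z. g z * z ^ M)) - toeplitz (\<lambda>z. k z * z ^ M)) (poly p) = 0" for p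
    by (intro ext) simp
  then have "finite_rank ((toeplitz f \<circ> toeplitz (\<lambda>z. g z * z ^ M)) - toeplitz (\<lambda>z. k z * z ^ M))"
    unfolding finite_rank_def by (intro exI[of _ "{}"]) auto
  with ki show "\<exists>M::nat. integrable dA (\<lambda>z. k z * z ^ M) \<and>
      finite_rank ((toeplitz f \<circ> toeplitz (\<lambda>z. g z * z ^ M)) - toeplitz (\<lambda>z. k z * z ^ M))"
    by blast
next
  fix N :: nat and F G K :: "nat \<Rightarrow> complex \<Rightarrow> complex" and H :: "complex \<Rightarrow> complex"
  assume FGK: "\<forall>j\<in>{1..N}. F j \<in> SQH \<and> G j \<in> SQH \<and> is_diamond (F j) (G j) (K j)"
    and H: "integrable dA H"
  let ?S = "(\<Sum>j=1..N. toeplitz (F j) \<circ> toeplitz (G j)) - toeplitz H"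
  have S: "?S h z = (\<Sum>j=1..N. toeplitz (F j) (toeplitz (G j) h) z) - toeplitz H h z" for h z
    by (simp add: sum_fun_apply)
  have Fi: "integrable dA (F j)" if "j \<in> {1..N}" for j using FGK that by (auto intro: SQH_integrable)
  have S_poly: "?S (poly p) = (\<Sum>i\<le>degree p. fun_scale (coeff p i) (?S (\<lambda>w. w ^ i)))" for p
  proof
    fix z
    have FG: "toeplitz (F j) (toeplitz (G j) (poly p)) z =
        (\<Sum>i\<le>degree p. coeff p i * toeplitz (F j) (toeplitz (G j) (\<lambda>w. w ^ i)) z)" if "j \<in> {1..N}" for j
      unfolding poly_altdef[abs_def] using FGK that by (intro toeplitz_product_sum Fi) auto
    have "?S (poly p) z = (\<Sum>i\<le>degree p. coeff p i * ?S (\<lambda>w. w ^ i) z)"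
      unfolding S toeplitz_poly[OF H]
      by (simp add: FG right_diff_distrib sum_subtractf sum_distrib_left)
         (rule sum.swap)
    also have "\<dots> = (\<Sum>i\<le>degree p. fun_scale (coeff p i) (?S (\<lambda>w. w ^ i))) z"
      by (simp add: sum_fun_apply fun_scale_def)
    finally show "?S (poly p) z = \<dots>" .
  qed
  have "eventually (\<lambda>M. \<forall>j\<in>{1..N}. integrable dA (\<lambda>z. K j z * z ^ M) \<and>
      (\<forall>i. toeplitz (F j) (toeplitz (G j) (\<lambda>w. w ^ (i + M))) = toeplitz (\<lambda>z. K j z * z ^ M) (\<lambda>w. w ^ i))) sequentially"
    using FGK by (intro eventually_ball_finite ballI diamond_toeplitz_shift) auto
  then obtain M where Ki: "\<And>j. j \<in> {1..N} \<Longrightarrow> integrable dA (\<lambda>z. K j z * z ^ M)"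
    and shift: "\<And>i j. j \<in> {1..N} \<Longrightarrow>
      toeplitz (F j) (toeplitz (G j) (\<lambda>w. w ^ (i + M))) = toeplitz (\<lambda>z. K j z * z ^ M) (\<lambda>w. w ^ i)"
    unfolding eventually_sequentially by blast
  \<comment> \<open>on monomials of degree at least \<open>M\<close> the operator acts as \<open>T\<^sub>V\<close>, whose symbol is integrable\<close>
  define V where "V z = (\<Sum>j=1..N. K j z * z ^ M) - H z * z ^ M" for z
  have KMi: "integrable dA (\<lambda>z. \<Sum>j=1..N. K j z * z ^ M)"
    by (rule Bochner_Integration.integrable_sum) (rule Ki)
  have HMi: "integrable dA (\<lambda>z. H z * z ^ M)"
    by (rule integrable_dA_mult_bounded(1)[OF H _ norm_power_le_1]) auto
  have Vi: "integrable dA V"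
    unfolding V_def using KMi HMi by (rule Bochner_Integration.integrable_diff)
  have S_shift: "?S (\<lambda>w. w ^ (i + M)) = toeplitz V (\<lambda>w. w ^ i)" for i
  proof
    fix z
    have "toeplitz H (\<lambda>w. w ^ (i + M)) = toeplitz (\<lambda>z. H z * z ^ M) (\<lambda>w. w ^ i)"
      by (simp add: toeplitz_def power_add mult_ac cong: if_cong)
    then have "?S (\<lambda>w. w ^ (i + M)) z =
        (\<Sum>j=1..N. toeplitz (\<lambda>z. K j z * z ^ M) (\<lambda>w. w ^ i) z) - toeplitz (\<lambda>z. H z * z ^ M) (\<lambda>w. w ^ i) z"
      unfolding S by (simp add: shift)
    also have "(\<Sum>j=1..N. toeplitz (\<lambda>z. K j z * z ^ M) (\<lambda>w. w ^ i) z) =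
        toeplitz (\<lambda>z. \<Sum>j=1..N. K j z * z ^ M) (\<lambda>w. w ^ i) z"
      by (rule toeplitz_symbol_sum[OF Ki _ norm_power_le_1, symmetric]) auto
    also have "\<dots> - toeplitz (\<lambda>z. H z * z ^ M) (\<lambda>w. w ^ i) z = toeplitz V (\<lambda>w. w ^ i) z"
      unfolding V_def[abs_def] by (rule toeplitz_diff_symbol[OF KMi HMi _ norm_power_le_1, symmetric]) auto
    finally show "?S (\<lambda>w. w ^ (i + M)) z = toeplitz V (\<lambda>w. w ^ i) z" .
  qed
  show "finite_rank ?S \<longleftrightarrow> integrable dA (\<lambda>z. \<Sum>j=1..N. K j z) \<and> (AE z in dA. H z = (\<Sum>j=1..N. K j z))"
  proof
    assume "finite_rank ?S"
    then obtain B where B: "finite B" "\<And>p. ?S (poly p) \<in> fun_space.span B"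
      unfolding finite_rank_def by blast
    have "toeplitz V (\<lambda>w. w ^ i) \<in> fun_space.span B" for i
    proof -
      have "(\<lambda>w :: complex. w ^ (i + M)) = poly (monom 1 (i + M))"
        by (simp add: poly_monom fun_eq_iff)
      then show ?thesis using B(2)[of "monom 1 (i + M)"] S_shift[of i] by simp
    qed
    then have "AE z in dA. V z = 0"
      by (rule toeplitz_finite_rank_imp_AE_0[OF Vi B(1)])
    with AE_dA_nz have eq: "AE z in dA. H z = (\<Sum>j=1..N. K j z)"
    proof eventually_elim
      case (elim z)
      then have "((\<Sum>j=1..N. K j z) - H z) * z ^ M = 0"
        by (simp add: V_def left_diff_distrib sum_distrib_right)
      then show ?case using elim(1) by simp
    qed
    then show "integrable dA (\<lambda>z. \<Sum>j=1..N. K j z) \<and> (AE z in dA. H z = (\<Sum>j=1..N. K j z))"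
      using integrable_cong_AE_dA[OF H eq] by blast
  next
    assume "integrable dA (\<lambda>z. \<Sum>j=1..N. K j z) \<and> (AE z in dA. H z = (\<Sum>j=1..N. K j z))"
    then have "AE z in dA. V z = 0"
      by (auto simp: V_def sum_distrib_right elim: eventually_mono)
    then have "toeplitz V (\<lambda>w. w ^ i) = toeplitz (\<lambda>_. 0) (\<lambda>w. w ^ i)" for i
      by (intro toeplitz_cong_AE[OF Vi]) auto
    then have zero: "?S (\<lambda>w. w ^ (i + M)) = 0" for i
      unfolding S_shift by (intro ext) (simp add: toeplitz_def)
    let ?B = "(\<lambda>i. ?S (\<lambda>w. w ^ i)) ` {..<M}"
    have mono: "?S (\<lambda>w. w ^ i) \<in> fun_space.span ?B" for i
    proof (cases "i < M")
      case True
      then show ?thesis by (intro fun_space.span_base imageI) simp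
    next
      case False
      then show ?thesis using zero[of "i - M"] fun_space.span_zero[of ?B] by simp
    qed
    have "?S (poly p) \<in> fun_space.span ?B" for p
      unfolding S_poly by (intro fun_space.span_sum fun_space.span_scale mono)
    then show "finite_rank ?S"
      unfolding finite_rank_def by (intro exI[of _ ?B]) auto
  qed
qed

end
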